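(* Let $k\ge 1$ be an integer and let $A$ be an $n$-by-$n$ complex matrix with $\|A\|=\|A^k\|=1$. Then $w(A)\ge\cos(\pi/(k+2))$. Moreover, in this case, the following conditions are equivalent: (a) $w(A)=\cos(\pi/(k+2))$; (b) $A$ is unitarily similar to $J_{k+1}\oplus B$, where $B$ is a finite square matrix with $w(B)\le\cos(\pi/(k+2))$; (c) $W(A)=\{z\in\mathbb{C}: |z|\le\cos(\pi/(k+2))\}$.
   Context: $\|\cdot\|$ is the operator norm. $W(X)=\{\langle Xx,x\rangle : \|x\|=1\}$ is the numerical range and $w(X)=\max\{|z|: z\in W(X)\}$ the numerical radius of a square complex matrix $X$. $J_\ell$ is the $\ell$-by-$\ell$ nilpotent Jordan block (ones on the first superdiagonal, zeros elsewhere). In (b), $B$ has size $n-k-1$ and is allowed to be absent (size $0$, with the condition on $w(B)$ vacuous). *)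

theory Defs
  imports
    Complex_Main
    "Jordan_Normal_Form.Jordan_Normal_Form"
    "Jordan_Normal_Form.Schur_Decomposition"
begin

definition l2_norm_vec :: "complex vec \<Rightarrow> real" where
  "l2_norm_vec v = sqrt (Re (v \<bullet>c v))"

text \<open>The supremum is taken over the closed unit ball, not the unit sphere, so that it is also
  meaningful for a matrix without columns, which gets norm 0.\<close>

definition op_norm :: "complex mat \<Rightarrow> real" where
  "op_norm X = Sup {l2_norm_vec (X *\<^sub>v x) | x. x \<in> carrier_vec (dim_col X) \<and> l2_norm_vec x \<le> 1}"

definition numerical_range :: "complex mat \<Rightarrow> complex set" where
  "numerical_range X = {(X *\<^sub>v x) \<bullet>c x | x. x \<in> carrier_vec (dim_col X) \<and> l2_norm_vec x = 1}"

text \<open>For square \<open>X\<close> of size at least 1, the numerical range is nonempty and compact, so this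
  supremum is the maximum. For size 0 the numerical range is empty and the value is meaningless.\<close>

definition numerical_radius :: "complex mat \<Rightarrow> real" where
  "numerical_radius X = Sup (cmod ` numerical_range X)"

text \<open>\<^const>\<open>similar_mat_wit\<close> includes both \<open>U * U\<^sup>* = 1\<close> and \<open>U\<^sup>* * U = 1\<close>, so the
  witness \<open>U\<close> is unitary.\<close>

definition unitarily_similar :: "complex mat \<Rightarrow> complex mat \<Rightarrow> bool" where
  "unitarily_similar X Y \<longleftrightarrow> (\<exists>U. similar_mat_wit X Y U (mat_adjoint U))"

end

theory Submission
  imports
    Defs
    "HOL-Analysis.Function_Topology"
    "HOL-Analysis.L2_Norm"
begin

text \<open>
  Let \<open>c = cos (\<pi> / (k + 2))\<close>. A maximising vector of \<open>A\<^sup>k\<close> gives unit vectors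
  \<open>x\<^sub>j = A\<^sup>j x\<^sub>0\<close>, \<open>j \<le> k\<close>, and since \<open>A\<close> is a contraction, \<open>A\<^sup>* x\<^sub>j\<^sub>+\<^sub>1 = x\<^sub>j\<close> for \<open>j < k\<close>.
  With \<open>a\<^sub>j = sin ((j + 1) \<pi> / (k + 2))\<close> put \<open>y(\<omega>) = \<Sum>\<^sub>j a\<^sub>j \<omega>\<^sup>j x\<^sub>j\<close>. Averaging over the
  roots of unity of order \<open>k + 3\<close> kills all cross terms: the mean of \<open>\<parallel>y(\<omega>)\<parallel>\<^sup>2\<close> is
  \<open>\<Sum>\<^sub>j a\<^sub>j\<^sup>2\<close>, and that of \<open>\<omega> \<langle>A y(\<omega>), y(\<omega>)\<rangle>\<close> is \<open>\<Sum>\<^sub>j a\<^sub>j a\<^sub>j\<^sub>+\<^sub>1 = c \<Sum>\<^sub>j a\<^sub>j\<^sup>2\<close>,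
  so \<open>w(A) \<ge> c\<close>. If \<open>w(A) = c\<close>, then every \<open>y(\<omega>)\<close> is extremal, which forces
  \<open>\<omega> A y(\<omega>) + \<omega>\<^sup>-\<^sup>1 A\<^sup>* y(\<omega>) = 2 c y(\<omega>)\<close>. The extreme Fourier coefficients of this identity are
  \<open>A x\<^sub>k = 0\<close> and \<open>A\<^sup>* x\<^sub>0 = 0\<close>. Hence the \<open>x\<^sub>j\<close> are orthonormal and span a reducing subspace
  on which \<open>A\<close> is the Jordan block.
\<close>

section \<open>Inner product and norm of complex vectors\<close>

lemma cscalar_prod_sum:
  fixes v w :: "complex vec"
  assumes "w \<in> carrier_vec n"
  shows "v \<bullet>c w = (\<Sum>i<n. v $ i * cnj (w $ i))"
  using assms by (auto simp: scalar_prod_def atLeast0LessThan intro!: sum.cong)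

lemma mat_adjoint_dim [simp]:
  "dim_row (mat_adjoint A) = dim_col A" "dim_col (mat_adjoint A) = dim_row A"
  by (auto simp: mat_adjoint_def)

lemma mat_adjoint_carrier [simp]:
  "A \<in> carrier_mat n m \<Longrightarrow> mat_adjoint A \<in> carrier_mat m n"
  by auto

lemma mat_adjoint_index [simp]:
  fixes A :: "complex mat"
  assumes "i < dim_col A" "j < dim_row A"
  shows "mat_adjoint A $$ (i, j) = cnj (A $$ (j, i))"
  using assms by (simp add: mat_adjoint_def mat_of_rows_def)

lemma mult_mat_vec_index_sum:
  assumes "A \<in> carrier_mat n m" "v \<in> carrier_vec m" "i < n"
  shows "(A *\<^sub>v v) $ i = (\<Sum>j<m. A $$ (i, j) * v $ j)"
  using assms by (auto simp: scalar_prod_def atLeast0LessThan intro!: sum.cong)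

lemma cscalar_prod_adjoint:
  fixes A :: "complex mat"
  assumes A: "A \<in> carrier_mat n m" and v: "v \<in> carrier_vec m" and w: "w \<in> carrier_vec n"
  shows "(A *\<^sub>v v) \<bullet>c w = v \<bullet>c (mat_adjoint A *\<^sub>v w)"
proof -
  have Aw: "mat_adjoint A *\<^sub>v w \<in> carrier_vec m"
    using A w by (intro mult_mat_vec_carrier[of _ m n]) simp_all
  have "(A *\<^sub>v v) \<bullet>c w = (\<Sum>i<n. \<Sum>j<m. A $$ (i, j) * v $ j * cnj (w $ i))"
    using w A v by (simp add: cscalar_prod_sum[OF w] mult_mat_vec_index_sum[OF A v] sum_distrib_right
        del: index_mult_mat_vec)
  also have "\<dots> = (\<Sum>j<m. \<Sum>i<n. A $$ (i, j) * v $ j * cnj (w $ i))"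
    by (rule sum.swap)
  also have "\<dots> = v \<bullet>c (mat_adjoint A *\<^sub>v w)"
    using A w by (auto simp: cscalar_prod_sum[OF Aw] mult_mat_vec_index_sum[OF mat_adjoint_carrier[OF A] w]
        sum_distrib_left mult_ac simp del: index_mult_mat_vec intro!: sum.cong)
  finally show ?thesis .
qed

lemma cscalar_prod_add_left:
  fixes u v w :: "complex vec"
  assumes "u \<in> carrier_vec n" "v \<in> carrier_vec n" "w \<in> carrier_vec n"
  shows "(u + v) \<bullet>c w = u \<bullet>c w + v \<bullet>c w"
  using assms by (simp add: add_scalar_prod_distrib)

lemma cscalar_prod_add_right:
  fixes u v w :: "complex vec"
  assumes "u \<in> carrier_vec n" "v \<in> carrier_vec n" "w \<in> carrier_vec n"
  shows "u \<bullet>c (v + w) = u \<bullet>c v + u \<bullet>c w"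
  using assms by (simp add: conjugate_add_vec scalar_prod_add_distrib)

lemma cscalar_prod_smult_left:
  fixes u v :: "complex vec"
  assumes "u \<in> carrier_vec n" "v \<in> carrier_vec n"
  shows "(a \<cdot>\<^sub>v u) \<bullet>c v = a * (u \<bullet>c v)"
  using assms by simp

lemma cscalar_prod_smult_right:
  fixes u v :: "complex vec"
  assumes "u \<in> carrier_vec n" "v \<in> carrier_vec n"
  shows "u \<bullet>c (a \<cdot>\<^sub>v v) = cnj a * (u \<bullet>c v)"
  using assms by (simp add: conjugate_smult_vec)

lemma cscalar_prod_cnj:
  fixes u v :: "complex vec"
  assumes "u \<in> carrier_vec n" "v \<in> carrier_vec n"
  shows "cnj (u \<bullet>c v) = v \<bullet>c u"
  using assms by (simp add: cscalar_prod_sum mult_ac)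

lemma l2_norm_vec_eq_L2_set:
  "l2_norm_vec v = L2_set (\<lambda>i. cmod (v $ i)) {..<dim_vec v}"
proof -
  have "v \<bullet>c v = (\<Sum>i<dim_vec v. of_real ((cmod (v $ i))\<^sup>2))"
    by (simp add: cscalar_prod_sum[OF carrier_vec_dim_vec] complex_norm_square del: of_real_power)
  then show ?thesis
    by (simp add: l2_norm_vec_def L2_set_def)
qed

lemma l2_norm_vec_nonneg [simp]: "0 \<le> l2_norm_vec v"
  by (simp add: l2_norm_vec_eq_L2_set)

lemma cscalar_prod_self: "v \<bullet>c v = of_real ((l2_norm_vec v)\<^sup>2)"
proof -
  have "v \<bullet>c v = (\<Sum>i<dim_vec v. of_real ((cmod (v $ i))\<^sup>2))"
    by (simp add: cscalar_prod_sum[OF carrier_vec_dim_vec] complex_norm_square del: of_real_power)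
  then show ?thesis
    by (simp add: l2_norm_vec_eq_L2_set L2_set_def sum_nonneg)
qed

lemma l2_norm_vec_sq: "v \<in> carrier_vec n \<Longrightarrow> (l2_norm_vec v)\<^sup>2 = (\<Sum>i<n. (cmod (v $ i))\<^sup>2)"
  by (auto simp: l2_norm_vec_eq_L2_set L2_set_def sum_nonneg)

lemma l2_norm_vec_eq_0_iff:
  "v \<in> carrier_vec n \<Longrightarrow> l2_norm_vec v = 0 \<longleftrightarrow> v = 0\<^sub>v n"
  by (auto simp: l2_norm_vec_eq_L2_set L2_set_eq_0_iff)

lemma l2_norm_vec_smult: "l2_norm_vec (a \<cdot>\<^sub>v v) = cmod a * l2_norm_vec v"
  by (auto simp: l2_norm_vec_eq_L2_set L2_set_right_distrib norm_mult intro!: L2_set_cong)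

lemma norm_cscalar_prod_le:
  assumes v: "v \<in> carrier_vec n" and w: "w \<in> carrier_vec n"
  shows "cmod (v \<bullet>c w) \<le> l2_norm_vec v * l2_norm_vec w"
proof -
  have "cmod (v \<bullet>c w) \<le> (\<Sum>i<n. \<bar>cmod (v $ i)\<bar> * \<bar>cmod (w $ i)\<bar>)"
    unfolding cscalar_prod_sum[OF w] by (rule sum_norm_le) (simp add: norm_mult)
  also have "\<dots> \<le> L2_set (\<lambda>i. cmod (v $ i)) {..<n} * L2_set (\<lambda>i. cmod (w $ i)) {..<n}"
    by (rule L2_set_mult_ineq)
  finally show ?thesis
    using v w by (simp add: l2_norm_vec_eq_L2_set)
qed

section \<open>Compactness and attainment of the operator norm\<close>

lemma compact_cube:
  "compact {f :: nat \<Rightarrow> complex.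
     (\<forall>i<n. \<bar>Re (f i)\<bar> \<le> 1 \<and> \<bar>Im (f i)\<bar> \<le> 1) \<and> (\<forall>i\<ge>n. f i = 0)}" (is "compact ?C")
proof -
  define Q where "Q = (\<lambda>p. of_real (fst p) + \<i> * of_real (snd p)) ` ({-1..1 :: real} \<times> {-1..1 :: real})"
  have "compact Q"
    unfolding Q_def
    by (intro compact_continuous_image continuous_intros compact_Times compact_Icc)
  have Q: "z \<in> Q \<longleftrightarrow> \<bar>Re z\<bar> \<le> 1 \<and> \<bar>Im z\<bar> \<le> 1" for z
  proof
    assume "\<bar>Re z\<bar> \<le> 1 \<and> \<bar>Im z\<bar> \<le> 1"
    then show "z \<in> Q"
      unfolding Q_def by (intro image_eqI[of _ _ "(Re z, Im z)"]) (auto simp: complex_eq_iff)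
  qed (auto simp: Q_def)
  \<comment> \<open>The first \<open>n\<close> coordinates range over a compact square of the plane
    and all others over \<open>{0}\<close>, so the set is a product of compact sets and Tychonoff's
    theorem applies.\<close>
  have "?C = Pi\<^sub>E UNIV (\<lambda>i. if i < n then Q else {0})"
    by (auto simp: PiE_def Pi_def Q not_less split: if_splits)
  moreover have "compactin (product_topology (\<lambda>i. euclidean) UNIV) (Pi\<^sub>E UNIV (\<lambda>i. if i < n then Q else {0}))"
    unfolding compactin_PiE using \<open>compact Q\<close> by (auto simp: compactin_euclidean_iff)
  ultimately show ?thesis
    by (simp add: euclidean_product_topology compactin_euclidean_iff)
qed

text \<open>Vectors are read as functions supported below \<open>n\<close>. There the unit ball is a
  closed subset of a compact cube, so the continuous norm of the image has a maximum; the bound for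
  arbitrary \<open>y\<close> follows by scaling.\<close>

lemma op_norm_attained:
  assumes A: "A \<in> carrier_mat n n"
  obtains x where "x \<in> carrier_vec n" "l2_norm_vec x \<le> 1" "l2_norm_vec (A *\<^sub>v x) = op_norm A"
    "\<And>y. y \<in> carrier_vec n \<Longrightarrow> l2_norm_vec (A *\<^sub>v y) \<le> op_norm A * l2_norm_vec y"
proof -
  let ?C = "{f :: nat \<Rightarrow> complex.
     (\<forall>i<n. \<bar>Re (f i)\<bar> \<le> 1 \<and> \<bar>Im (f i)\<bar> \<le> 1) \<and> (\<forall>i\<ge>n. f i = 0)}"
  let ?D = "{f. (\<Sum>i<n. (cmod (f i))\<^sup>2) \<le> 1}"
  have eval_cont [continuous_intros]: "continuous_on S (\<lambda>f :: nat \<Rightarrow> complex. f i)" for S i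
    by (rule continuous_on_subset[OF continuous_on_product_coordinates]) simp
  have "closed ?D"
    by (intro closed_Collect_le continuous_intros)
  then have cpt: "compact (?C \<inter> ?D)"
    using compact_cube by (rule compact_Int_closed[rotated])
  let ?g = "\<lambda>f :: nat \<Rightarrow> complex. L2_set (\<lambda>i. cmod (\<Sum>j<n. A $$ (i, j) * f j)) {..<n}"
  have g: "continuous_on (?C \<inter> ?D) ?g"
    unfolding L2_set_def by (intro continuous_intros)
  have "(\<lambda>_. 0) \<in> ?C \<inter> ?D"
    by simp
  then have "\<exists>f\<in>?C \<inter> ?D. \<forall>h\<in>?C \<inter> ?D. ?g h \<le> ?g f"
    by (intro continuous_attains_sup[OF cpt _ g]) (rule ex_in_conv[THEN iffD1], rule exI)
  then obtain f where f: "f \<in> ?C \<inter> ?D" and fmax: "\<And>h. h \<in> ?C \<inter> ?D \<Longrightarrow> ?g h \<le> ?g f"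
    by (rule bexE) (rule that, assumption, erule (1) bspec)
  have to_vec: "l2_norm_vec (A *\<^sub>v v) = ?g (\<lambda>i. if i < n then v $ i else 0)" if "v \<in> carrier_vec n" for v
  proof -
    have "cmod ((A *\<^sub>v v) $ i) = cmod (\<Sum>j<n. A $$ (i, j) * (if j < n then v $ j else 0))"
      if "i < n" for i
      unfolding mult_mat_vec_index_sum[OF A \<open>v \<in> carrier_vec n\<close> that]
      by (intro arg_cong[where f = cmod] sum.cong) auto
    then show ?thesis
      using A unfolding l2_norm_vec_eq_L2_set by (intro L2_set_cong) auto
  qed
  have max1: "l2_norm_vec (A *\<^sub>v v) \<le> ?g f" if v: "v \<in> carrier_vec n" and le: "l2_norm_vec v \<le> 1" for v
  proof -
    have sq: "(\<Sum>i<n. (cmod (v $ i))\<^sup>2) \<le> 1"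
      unfolding l2_norm_vec_sq[OF v, symmetric] using le by (simp add: power_le_one)
    have "\<bar>Re (v $ i)\<bar> \<le> 1 \<and> \<bar>Im (v $ i)\<bar> \<le> 1" if "i < n" for i
    proof -
      have "(cmod (v $ i))\<^sup>2 \<le> (\<Sum>i<n. (cmod (v $ i))\<^sup>2)"
        using that by (intro member_le_sum) auto
      then have "cmod (v $ i) \<le> 1"
        using sq by (simp add: power2_le_imp_le[where y = 1])
      then show ?thesis
        using abs_Re_le_cmod[of "v $ i"] abs_Im_le_cmod[of "v $ i"] by linarith
    qed
    then show ?thesis
      using sq unfolding to_vec[OF v] by (intro fmax) auto
  qed
  define x where "x = vec n f"
  have x: "x \<in> carrier_vec n"
    by (simp add: x_def)
  have gx: "l2_norm_vec (A *\<^sub>v x) = ?g f"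
    unfolding to_vec[OF x]
    by (intro L2_set_cong refl arg_cong[where f = cmod] sum.cong) (auto simp: x_def)
  have x1: "l2_norm_vec x \<le> 1"
    using f by (simp add: l2_norm_vec_eq_L2_set x_def L2_set_def)
  have op: "op_norm A = ?g f"
    unfolding op_norm_def
  proof (rule cSup_eq_maximum)
    show "?g f \<in> {l2_norm_vec (A *\<^sub>v x) |x. x \<in> carrier_vec (dim_col A) \<and> l2_norm_vec x \<le> 1}"
      using x x1 gx A by (auto intro!: exI[of _ x])
    show "y \<le> ?g f" if "y \<in> {l2_norm_vec (A *\<^sub>v x) |x. x \<in> carrier_vec (dim_col A) \<and> l2_norm_vec x \<le> 1}" for y
      using that max1 A by auto
  qed
  have "l2_norm_vec (A *\<^sub>v y) \<le> op_norm A * l2_norm_vec y" if y: "y \<in> carrier_vec n" for y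
  proof (cases "l2_norm_vec y = 0")
    case True
    then have "y = 0\<^sub>v n"
      using y by (simp add: l2_norm_vec_eq_0_iff)
    moreover have "A *\<^sub>v 0\<^sub>v n = 0\<^sub>v n"
      using A by auto
    ultimately have "A *\<^sub>v y = y"
      by simp
    then show ?thesis
      using True by simp
  next
    case False
    let ?c = "of_real (1 / l2_norm_vec y) :: complex"
    have "l2_norm_vec (A *\<^sub>v (?c \<cdot>\<^sub>v y)) \<le> op_norm A"
      unfolding op using False y by (intro max1) (simp_all add: l2_norm_vec_smult norm_divide)
    then have "1 / l2_norm_vec y * l2_norm_vec (A *\<^sub>v y) \<le> op_norm A"
      using A y by (simp add: mult_mat_vec l2_norm_vec_smult norm_divide del: of_real_divide)
    moreover have "l2_norm_vec y > 0"
      using False l2_norm_vec_nonneg[of y] by linarith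
    ultimately show ?thesis
      by (simp add: field_simps)
  qed
  then show ?thesis
    using that x x1 gx op by simp
qed

section \<open>Numerical range and numerical radius\<close>

text \<open>Cauchy-Schwarz bounds the range by \<open>op_norm A\<close>. Only with such a bound is
  the real \<open>Sup\<close> an upper bound.\<close>

lemma bdd_above_numerical_range:
  assumes A: "A \<in> carrier_mat n n"
  shows "bdd_above (cmod ` numerical_range A)"
proof -
  obtain x where bound: "\<And>y. y \<in> carrier_vec n \<Longrightarrow> l2_norm_vec (A *\<^sub>v y) \<le> op_norm A * l2_norm_vec y"
    using op_norm_attained[OF A] by metis
  have "cmod ((A *\<^sub>v y) \<bullet>c y) \<le> op_norm A"
    if y: "y \<in> carrier_vec n" and y1: "l2_norm_vec y = 1" for y
    using norm_cscalar_prod_le[OF mult_mat_vec_carrier[OF A y] y] bound[OF y] y1 by simp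
  then show ?thesis
    using A by (intro bdd_aboveI[of _ "op_norm A"]) (auto simp: numerical_range_def)
qed

text \<open>The homogeneous form of the supremum. It also covers the zero vector, and with it size
  0, where \<open>numerical_radius\<close> carries no information.\<close>

lemma norm_cscalar_prod_le_numerical_radius:
  assumes A: "A \<in> carrier_mat n n" and y: "y \<in> carrier_vec n"
  shows "cmod ((A *\<^sub>v y) \<bullet>c y) \<le> numerical_radius A * (l2_norm_vec y)\<^sup>2"
proof (cases "l2_norm_vec y = 0")
  case True
  then show ?thesis
    using norm_cscalar_prod_le[OF mult_mat_vec_carrier[OF A y] y] by simp
next
  case False
  define c where "c = complex_of_real (1 / l2_norm_vec y)"
  have c: "cmod c = 1 / l2_norm_vec y"
    by (simp add: c_def norm_divide)
  have "l2_norm_vec (c \<cdot>\<^sub>v y) = 1"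
    using False by (simp add: l2_norm_vec_smult c)
  then have "(A *\<^sub>v (c \<cdot>\<^sub>v y)) \<bullet>c (c \<cdot>\<^sub>v y) \<in> numerical_range A"
    using A y by (auto simp: numerical_range_def intro!: exI[of _ "c \<cdot>\<^sub>v y"])
  then have "cmod ((A *\<^sub>v (c \<cdot>\<^sub>v y)) \<bullet>c (c \<cdot>\<^sub>v y)) \<le> numerical_radius A"
    unfolding numerical_radius_def by (intro cSup_upper bdd_above_numerical_range[OF A]) auto
  moreover have "(A *\<^sub>v (c \<cdot>\<^sub>v y)) \<bullet>c (c \<cdot>\<^sub>v y) = c * cnj c * ((A *\<^sub>v y) \<bullet>c y)"
    using cscalar_prod_smult_left[of "A *\<^sub>v y" n "c \<cdot>\<^sub>v y" c]
      cscalar_prod_smult_right[of "A *\<^sub>v y" n y c] A y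
    by (simp add: mult_mat_vec)
  ultimately have "cmod c * cmod c * cmod ((A *\<^sub>v y) \<bullet>c y) \<le> numerical_radius A"
    by (simp add: norm_mult)
  moreover have "0 < (l2_norm_vec y)\<^sup>2"
    using False by simp
  ultimately show ?thesis
    by (simp add: c field_simps power2_eq_square)
qed

lemma numerical_range_nonempty:
  assumes "A \<in> carrier_mat n n" "0 < n"
  shows "numerical_range A \<noteq> {}"
proof -
  have "l2_norm_vec (unit_vec n 0) = 1"
    using assms(2) by (simp add: l2_norm_vec_def)
  then show ?thesis
    using assms by (auto simp: numerical_range_def intro!: exI[of _ "unit_vec n 0"])
qed

section \<open>Equality cases for contractions and for numerical bounds\<close>

text \<open>For \<open>u = A^* A y\<close> one has |u| <= |A y| = |y| and <u, y> = |y|^2, so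
  expanding the square gives |u - y|^2 = |u|^2 - |y|^2 <= 0.\<close>

lemma contraction_adjoint_fix:
  assumes A: "A \<in> carrier_mat n n"
    and contr: "\<And>y. y \<in> carrier_vec n \<Longrightarrow> l2_norm_vec (A *\<^sub>v y) \<le> l2_norm_vec y"
    and y: "y \<in> carrier_vec n" and iso: "l2_norm_vec (A *\<^sub>v y) = l2_norm_vec y"
  shows "mat_adjoint A *\<^sub>v (A *\<^sub>v y) = y"
proof -
  define z where "z = A *\<^sub>v y"
  define u where "u = mat_adjoint A *\<^sub>v z"
  have z: "z \<in> carrier_vec n" and u: "u \<in> carrier_vec n" and Au: "A *\<^sub>v u \<in> carrier_vec n"
    using A y by (auto simp: z_def u_def intro!: mult_mat_vec_carrier[of _ n n])
  \<comment> \<open>Since |u|^2 = <A u, z>, Cauchy-Schwarz and the contraction property give |u| <=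
    |z|: the adjoint is contractive too.\<close>
  have "cmod (u \<bullet>c u) = cmod ((A *\<^sub>v u) \<bullet>c z)"
    by (simp add: cscalar_prod_adjoint[OF A u z, folded u_def])
  then have "(l2_norm_vec u)\<^sup>2 \<le> l2_norm_vec (A *\<^sub>v u) * l2_norm_vec z"
    using norm_cscalar_prod_le[OF Au z] by (simp add: cscalar_prod_self norm_power)
  also have "\<dots> \<le> l2_norm_vec u * l2_norm_vec z"
    by (intro mult_right_mono contr u) simp
  finally have "l2_norm_vec u \<le> l2_norm_vec z"
    by (metis l2_norm_vec_nonneg mult_le_cancel_left_pos order_antisym_conv power2_eq_square linorder_le_less_linear)
  then have uz: "(l2_norm_vec u)\<^sup>2 \<le> (l2_norm_vec y)\<^sup>2"
    by (simp add: power_mono z_def iso)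
  have yu: "y \<bullet>c u = z \<bullet>c z"
    using cscalar_prod_adjoint[OF A y z] by (simp add: u_def z_def)
  have "u \<bullet>c y = cnj (y \<bullet>c u)"
    by (simp add: cscalar_prod_cnj[OF y u])
  then have uy: "u \<bullet>c y = of_real ((l2_norm_vec y)\<^sup>2)" and yu': "y \<bullet>c u = of_real ((l2_norm_vec y)\<^sup>2)"
    unfolding yu by (simp_all add: cscalar_prod_self z_def iso)
  define d where "d = u + (-1) \<cdot>\<^sub>v y"
  have d: "d \<in> carrier_vec n" and y': "(-1) \<cdot>\<^sub>v y \<in> carrier_vec n"
    using u y by (auto simp: d_def)
  have "d \<bullet>c d = u \<bullet>c u - u \<bullet>c y - y \<bullet>c u + y \<bullet>c y"
    unfolding d_def
    by (simp add: cscalar_prod_add_left[OF u y' d[unfolded d_def]] cscalar_prod_add_right[OF u u y']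
        cscalar_prod_add_right[OF y' u y'] cscalar_prod_smult_left[OF y u]
        cscalar_prod_smult_left[OF y y'] cscalar_prod_smult_right[OF u y] cscalar_prod_smult_right[OF y y]
        del: scalar_prod_smult_distrib smult_scalar_prod_distrib)
  then have "of_real ((l2_norm_vec d)\<^sup>2) = complex_of_real ((l2_norm_vec u)\<^sup>2 - (l2_norm_vec y)\<^sup>2)"
    unfolding uy yu' cscalar_prod_self by simp
  then have "(l2_norm_vec d)\<^sup>2 = (l2_norm_vec u)\<^sup>2 - (l2_norm_vec y)\<^sup>2"
    by (simp only: of_real_eq_iff)
  then have "(l2_norm_vec d)\<^sup>2 \<le> 0"
    using uz by simp
  then have "d = 0\<^sub>v n"
    using d by (simp add: l2_norm_vec_eq_0_iff)
  then have "d $ i = 0" if "i < n" for i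
    using that by simp
  then have "u $ i = y $ i" if "i < n" for i
    using that u y unfolding d_def by simp
  then have "u = y"
    using u y by (intro eq_vecI) auto
  then show ?thesis
    by (simp add: u_def z_def)
qed

lemma linear_le_quadratic_imp_zero:
  fixes a b :: real
  assumes "\<And>t. t * a \<le> t\<^sup>2 * b"
  shows "a = 0"
proof (rule ccontr)
  assume "a \<noteq> 0"
  \<comment> \<open>For this \<open>t\<close> the hypothesis reads t^2 (|b| + 1) <= t^2 b, which
    forces t = 0.\<close>
  define t where "t = a / (\<bar>b\<bar> + 1)"
  have t: "t * (\<bar>b\<bar> + 1) = a"
    by (simp add: t_def add_pos_nonneg)
  have "t\<^sup>2 * (\<bar>b\<bar> + 1) = t * a"
    by (simp add: power2_eq_square flip: t)
  also have "\<dots> \<le> t\<^sup>2 * b"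
    by (rule assms)
  finally have "t\<^sup>2 * (\<bar>b\<bar> + 1 - b) \<le> 0"
    by (simp add: algebra_simps)
  moreover have "0 < t\<^sup>2"
    using t \<open>a \<noteq> 0\<close> by auto
  ultimately show False
    by (simp add: mult_le_0_iff)
qed

text \<open>Vanishing of the first variation of the positive form
  \<open>c \<parallel>y\<parallel>\<^sup>2 - Re (\<omega> \<langle>A y, y\<rangle>)\<close> at one of its zeros.\<close>

lemma numerical_bound_equality:
  assumes A: "A \<in> carrier_mat n n"
    and bound: "\<And>y. y \<in> carrier_vec n \<Longrightarrow> Re (\<omega> * ((A *\<^sub>v y) \<bullet>c y)) \<le> c * (l2_norm_vec y)\<^sup>2"
    and y: "y \<in> carrier_vec n" and z: "z \<in> carrier_vec n"
    and eq: "Re (\<omega> * ((A *\<^sub>v y) \<bullet>c y)) = c * (l2_norm_vec y)\<^sup>2"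
  shows "\<omega> * ((A *\<^sub>v y) \<bullet>c z) + cnj \<omega> * ((mat_adjoint A *\<^sub>v y) \<bullet>c z) = 2 * of_real c * (y \<bullet>c z)"
proof -
  \<comment> \<open>\<open>E w\<close> is the defect of the claimed identity at \<open>w\<close>; it
    is conjugate linear in \<open>w\<close>.\<close>
  define E where "E w = \<omega> * ((A *\<^sub>v y) \<bullet>c w) + cnj \<omega> * ((mat_adjoint A *\<^sub>v y) \<bullet>c w) - 2 * of_real c * (y \<bullet>c w)" for w
  have Ay: "A *\<^sub>v y \<in> carrier_vec n" and A'y: "mat_adjoint A *\<^sub>v y \<in> carrier_vec n"
    using A y by (auto intro!: mult_mat_vec_carrier[of _ n n])
  have E0: "Re (E w) = 0" if w: "w \<in> carrier_vec n" for w
  proof -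
    have Aw: "A *\<^sub>v w \<in> carrier_vec n"
      using A w by auto
    \<comment> \<open>The form vanishes at y, so at y + t w it equals t^2 b - t Re (E w). It is
      nonnegative for every real t, which kills the linear term.\<close>
    define b where "b = c * (l2_norm_vec w)\<^sup>2 - Re (\<omega> * ((A *\<^sub>v w) \<bullet>c w))"
    have "t * Re (E w) \<le> t\<^sup>2 * b" for t
    proof -
      let ?v = "of_real t \<cdot>\<^sub>v w"
      have v: "?v \<in> carrier_vec n" and Av: "A *\<^sub>v ?v = of_real t \<cdot>\<^sub>v (A *\<^sub>v w)" "of_real t \<cdot>\<^sub>v (A *\<^sub>v w) \<in> carrier_vec n"
        using A w by (auto simp: mult_mat_vec)
      have yv: "y + ?v \<in> carrier_vec n"
        using y v by simp
      have Awy: "(A *\<^sub>v w) \<bullet>c y = cnj ((mat_adjoint A *\<^sub>v y) \<bullet>c w)"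
        using cscalar_prod_adjoint[OF A w y] cscalar_prod_cnj[OF A'y w] by simp
      have "(A *\<^sub>v (y + ?v)) \<bullet>c (y + ?v) = (A *\<^sub>v y) \<bullet>c y + of_real t * ((A *\<^sub>v y) \<bullet>c w)
          + of_real t * cnj ((mat_adjoint A *\<^sub>v y) \<bullet>c w) + of_real (t\<^sup>2) * ((A *\<^sub>v w) \<bullet>c w)"
        using Awy by (simp add: mult_add_distrib_mat_vec[OF A y v] Av(1) cscalar_prod_add_left[OF Ay Av(2) yv]
          cscalar_prod_add_right[OF Ay y v] cscalar_prod_add_right[OF Av(2) y v]
          cscalar_prod_smult_left[OF Aw y] cscalar_prod_smult_left[OF Aw v]
          cscalar_prod_smult_right[OF Ay w] cscalar_prod_smult_right[OF Aw w] power2_eq_square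
          del: scalar_prod_smult_distrib smult_scalar_prod_distrib)
      then have 1: "Re (\<omega> * ((A *\<^sub>v (y + ?v)) \<bullet>c (y + ?v))) = Re (\<omega> * ((A *\<^sub>v y) \<bullet>c y))
          + t * Re (\<omega> * ((A *\<^sub>v y) \<bullet>c w) + cnj \<omega> * ((mat_adjoint A *\<^sub>v y) \<bullet>c w))
          + t\<^sup>2 * Re (\<omega> * ((A *\<^sub>v w) \<bullet>c w))"
        by (simp add: algebra_simps)
      have "(y + ?v) \<bullet>c (y + ?v) = y \<bullet>c y + of_real t * (y \<bullet>c w) + of_real t * cnj (y \<bullet>c w)
          + of_real (t\<^sup>2) * (w \<bullet>c w)"
        by (simp add: cscalar_prod_add_left[OF y v yv]
          cscalar_prod_add_right[OF y y v] cscalar_prod_add_right[OF v y v]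
          cscalar_prod_smult_left[OF w y] cscalar_prod_smult_left[OF w v] cscalar_prod_cnj[OF y w]
          cscalar_prod_smult_right[OF y w] cscalar_prod_smult_right[OF w w] power2_eq_square
          del: scalar_prod_smult_distrib smult_scalar_prod_distrib)
      then have "Re ((y + ?v) \<bullet>c (y + ?v)) = Re (y \<bullet>c y) + 2 * t * Re (y \<bullet>c w) + t\<^sup>2 * Re (w \<bullet>c w)"
        by simp
      then have 2: "(l2_norm_vec (y + ?v))\<^sup>2 = (l2_norm_vec y)\<^sup>2 + 2 * t * Re (y \<bullet>c w) + t\<^sup>2 * (l2_norm_vec w)\<^sup>2"
        unfolding cscalar_prod_self by simp
      from bound[OF yv] show ?thesis
        unfolding 1 2 eq b_def E_def by (simp add: algebra_simps)
    qed
    then show ?thesis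
      by (rule linear_le_quadratic_imp_zero)
  qed
  have iz: "\<i> \<cdot>\<^sub>v z \<in> carrier_vec n"
    using z by simp
  \<comment> \<open>The real part of E at i z is the imaginary part of E z, so the vanishing real
    parts at z and at i z together give E z = 0.\<close>
  have "E (\<i> \<cdot>\<^sub>v z) = - \<i> * E z"
    unfolding E_def by (simp add: cscalar_prod_smult_right[OF Ay z] cscalar_prod_smult_right[OF A'y z]
        cscalar_prod_smult_right[OF y z] algebra_simps)
  then have "E z = 0"
    using E0[OF z] E0[OF iz] by (simp add: complex_eq_iff)
  then show ?thesis
    by (simp add: E_def)
qed

section \<open>Roots of unity and the Fejer weights\<close>

definition unity_root :: "nat \<Rightarrow> nat \<Rightarrow> complex" where
  "unity_root N s = cis (2 * pi * real s / real N)"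

lemma norm_unity_root [simp]: "cmod (unity_root N s) = 1"
  by (simp add: unity_root_def)

lemma unity_root_mult_cnj [simp]: "unity_root N s * cnj (unity_root N s) = 1"
  by (simp add: unity_root_def cis_cnj cis_mult)

text \<open>The summands form a geometric sequence in \<open>s\<close> whose ratio is an N-th root
  of unity. The ratio is 1 only if N divides p - q, that is, if p = q, because both exponents lie
  below N.\<close>

lemma sum_unity_root:
  assumes "p < N" "q < N"
  shows "(\<Sum>s<N. unity_root N s ^ p * cnj (unity_root N s) ^ q) = (if p = q then of_nat N else 0)"
proof -
  define z where "z = cis (2 * pi * (real p - real q) / real N)"
  have N: "0 < N"
    using assms by simp
  have term_eq: "unity_root N s ^ p * cnj (unity_root N s) ^ q = z ^ s" for s
    unfolding unity_root_def z_def cis_cnj DeMoivre cis_mult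
    by (rule arg_cong[where f = cis]) (simp add: algebra_simps diff_divide_distrib)
  show ?thesis
  proof (cases "p = q")
    case True
    then show ?thesis
      unfolding term_eq by (simp add: z_def)
  next
    case False
    have "z ^ N = cis (2 * pi * of_int (int p - int q))"
      unfolding z_def DeMoivre using N by (intro arg_cong[where f = cis]) simp
    then have zN: "z ^ N = 1"
      by (simp only: cis_multiple_2pi Ints_of_int)
    have "z \<noteq> 1"
    proof
      assume "z = 1"
      then have "cos (2 * pi * (real p - real q) / real N) = 1"
        by (simp add: z_def complex_eq_iff)
      then obtain m :: int where "2 * pi * (real p - real q) / real N = of_int m * 2 * pi"
        unfolding cos_one_2pi_int by blast
      then have "(2 * pi) * (real p - real q) = (2 * pi) * (of_int m * real N)"
        using N by (simp add: divide_eq_eq mult_ac)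
      then have "real p - real q = of_int m * real N"
        unfolding mult_cancel_left by simp
      then have "of_int (int p - int q) = (of_int (m * int N) :: real)"
        by simp
      then have m: "int p - int q = m * int N"
        by (simp only: of_int_eq_iff)
      have "\<bar>m * int N\<bar> < int N"
        using assms unfolding m[symmetric] by linarith
      then have "\<bar>m\<bar> * int N < 1 * int N"
        by (simp only: abs_mult abs_of_nat mult_1)
      then have "m = 0"
        using N by (simp only: mult_less_cancel_right_pos of_nat_0_less_iff zabs_less_one_iff)
      then show False
        using m False by simp
    qed
    then show ?thesis
      unfolding term_eq using False zN by (simp add: geometric_sum)
  qed
qed

text \<open>Discrete Fourier inversion: a coefficient of a polynomial of degree below
  \<open>N\<close> is recovered from its values at the roots of unity. The exponent map
  \<open>p\<close> allows shifted powers.\<close>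

lemma unity_root_coefficient:
  assumes "finite J" "q < N" "\<And>j. j \<in> J \<Longrightarrow> p j < N"
  shows "(\<Sum>s<N. (\<Sum>j\<in>J. g j * unity_root N s ^ p j) * cnj (unity_root N s) ^ q)
    = of_nat N * (\<Sum>j | j \<in> J \<and> p j = q. g j)"
proof -
  have "(\<Sum>s<N. (\<Sum>j\<in>J. g j * unity_root N s ^ p j) * cnj (unity_root N s) ^ q)
      = (\<Sum>j\<in>J. g j * (\<Sum>s<N. unity_root N s ^ p j * cnj (unity_root N s) ^ q))"
    unfolding sum_distrib_left sum_distrib_right by (subst sum.swap) (simp add: mult_ac)
  also have "\<dots> = (\<Sum>j\<in>J. if p j = q then of_nat N * g j else 0)"
    using assms by (intro sum.cong refl) (simp add: sum_unity_root)
  also have "\<dots> = of_nat N * (\<Sum>j | j \<in> J \<and> p j = q. g j)"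
    by (simp add: sum.inter_filter[OF assms(1)] sum_distrib_left if_distrib cong: if_cong)
  finally show ?thesis .
qed

text \<open>The values at i = 1, ..., k + 1 form the positive eigenvector of \<open>J + J^*\<close>
  for the nilpotent Jordan block of size k + 1. Indices 0 and k + 2 carry the zero boundary
  values.\<close>

definition fejer :: "nat \<Rightarrow> nat \<Rightarrow> real" where
  "fejer k i = sin (real i * (pi / (real k + 2)))"

lemma fejer_0 [simp]: "fejer k 0 = 0"
  by (simp add: fejer_def)

lemma fejer_end [simp]: "fejer k (Suc (Suc k)) = 0"
proof -
  have "real (Suc (Suc k)) * (pi / (real k + 2)) = pi"
    by (simp add: field_simps)
  then show ?thesis
    by (simp only: fejer_def sin_pi)
qed

lemma fejer_pos:
  assumes "i \<le> k"
  shows "0 < fejer k (Suc i)"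
  unfolding fejer_def
proof (rule sin_gt_zero)
  show "0 < real (Suc i) * (pi / (real k + 2))"
    by simp
  have "real (Suc i) * pi < (real k + 2) * pi"
    using assms by (intro mult_strict_right_mono) auto
  then show "real (Suc i) * (pi / (real k + 2)) < pi"
    by (simp add: field_simps)
qed

lemma fejer_rec:
  "fejer k i + fejer k (Suc (Suc i)) = 2 * cos (pi / (real k + 2)) * fejer k (Suc i)"
proof -
  define t where "t = pi / (real k + 2)"
  have "sin (real i * t) = sin ((real i + 1) * t - t)" "sin (real (Suc (Suc i)) * t) = sin ((real i + 1) * t + t)"
    by (simp_all add: algebra_simps)
  then show ?thesis
    unfolding fejer_def t_def[symmetric] sin_add sin_diff by (simp add: algebra_simps)
qed

text \<open>Multiply the recurrence by its middle weight and sum. As the weights vanish at 0 and k +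
  2, the sums with the left and with the right neighbour agree.\<close>

lemma fejer_sum:
  "(\<Sum>i<k. fejer k (Suc i) * fejer k (Suc (Suc i)))
    = cos (pi / (real k + 2)) * (\<Sum>i\<le>k. (fejer k (Suc i))\<^sup>2)"
proof -
  let ?S = "fejer k"
  have "(\<Sum>i\<le>k. ?S (Suc i) * ?S i) = (\<Sum>i<k. ?S (Suc i) * ?S (Suc (Suc i)))"
    unfolding sum.atMost_shift by (simp add: mult_ac)
  moreover have "(\<Sum>i\<le>k. ?S (Suc i) * ?S (Suc (Suc i))) = (\<Sum>i<k. ?S (Suc i) * ?S (Suc (Suc i)))"
    by (simp add: lessThan_Suc_atMost[symmetric])
  ultimately have "2 * (\<Sum>i<k. ?S (Suc i) * ?S (Suc (Suc i)))
      = (\<Sum>i\<le>k. ?S (Suc i) * (?S i + ?S (Suc (Suc i))))"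
    by (simp add: ring_distribs sum.distrib)
  also have "\<dots> = 2 * (cos (pi / (real k + 2)) * (\<Sum>i\<le>k. (?S (Suc i))\<^sup>2))"
    unfolding fejer_rec by (simp add: sum_distrib_left power2_eq_square mult_ac)
  finally show ?thesis
    by simp
qed

text \<open>Each product is split by a weighted AM-GM with weights
  \<open>fejer k (i + 2) / fejer k (i + 1)\<close>; the recurrence makes the weights add up.\<close>

lemma fejer_inequality:
  "(\<Sum>i<k. b i * b (Suc i)) \<le> cos (pi / (real k + 2)) * (\<Sum>i\<le>k. (b i :: real)\<^sup>2)"
proof -
  let ?S = "fejer k"
  have nonzero: "?S (Suc i) \<noteq> 0" if "i \<le> k" for i
    using fejer_pos[OF that] by simp
  have "2 * (b i * b (Suc i)) \<le> ?S (Suc (Suc i)) / ?S (Suc i) * (b i)\<^sup>2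
      + ?S (Suc i) / ?S (Suc (Suc i)) * (b (Suc i))\<^sup>2" if "i < k" for i
  proof -
    have p: "0 < ?S (Suc i)" "0 < ?S (Suc (Suc i))"
      using fejer_pos[of i k] fejer_pos[of "Suc i" k] that by auto
    have "0 \<le> (?S (Suc (Suc i)) * b i - ?S (Suc i) * b (Suc i))\<^sup>2 / (?S (Suc i) * ?S (Suc (Suc i)))"
      using p by (intro divide_nonneg_pos) auto
    also have "\<dots> = ?S (Suc (Suc i)) / ?S (Suc i) * (b i)\<^sup>2
      + ?S (Suc i) / ?S (Suc (Suc i)) * (b (Suc i))\<^sup>2 - 2 * (b i * b (Suc i))"
      using p by (simp add: field_simps power2_eq_square)
    finally show ?thesis
      by simp
  qed
  then have "2 * (\<Sum>i<k. b i * b (Suc i)) \<le> (\<Sum>i<k. ?S (Suc (Suc i)) / ?S (Suc i) * (b i)\<^sup>2)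
      + (\<Sum>i<k. ?S (Suc i) / ?S (Suc (Suc i)) * (b (Suc i))\<^sup>2)"
    unfolding sum_distrib_left sum.distrib[symmetric] by (intro sum_mono) auto
  \<comment> \<open>The added term i = k vanishes by \<open>fejer_end\<close>; after the shift in
    the next sum, the added term i = 0 vanishes by \<open>fejer_0\<close>.\<close>
  also have "(\<Sum>i<k. ?S (Suc (Suc i)) / ?S (Suc i) * (b i)\<^sup>2) = (\<Sum>i\<le>k. ?S (Suc (Suc i)) / ?S (Suc i) * (b i)\<^sup>2)"
    by (simp add: lessThan_Suc_atMost[symmetric])
  also have "(\<Sum>i<k. ?S (Suc i) / ?S (Suc (Suc i)) * (b (Suc i))\<^sup>2) = (\<Sum>i\<le>k. ?S i / ?S (Suc i) * (b i)\<^sup>2)"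
    unfolding sum.atMost_shift by simp
  also have "(\<Sum>i\<le>k. ?S (Suc (Suc i)) / ?S (Suc i) * (b i)\<^sup>2) + (\<Sum>i\<le>k. ?S i / ?S (Suc i) * (b i)\<^sup>2)
      = (\<Sum>i\<le>k. (?S i + ?S (Suc (Suc i))) / ?S (Suc i) * (b i)\<^sup>2)"
    by (simp only: sum.distrib[symmetric] add_divide_distrib ring_distribs add.commute)
  also have "\<dots> = (\<Sum>i\<le>k. 2 * cos (pi / (real k + 2)) * (b i)\<^sup>2)"
    unfolding fejer_rec using nonzero by (intro sum.cong refl) simp
  finally show ?thesis
    by (simp add: sum_distrib_left[symmetric] mult.assoc)
qed

lemma fejer_square_sum_pos: "0 < (\<Sum>i\<le>k. (fejer k (Suc i))\<^sup>2)"
  by (intro sum_pos zero_less_power fejer_pos) auto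

section \<open>Orbits on which a contraction is isometric\<close>

text \<open>Written by coordinates, so that the dimension is fixed even for empty \<open>J\<close>
  and linearity reduces to exchanging finite sums.\<close>

definition lin_comb :: "nat \<Rightarrow> nat set \<Rightarrow> (nat \<Rightarrow> complex) \<Rightarrow> (nat \<Rightarrow> complex vec) \<Rightarrow> complex vec" where
  "lin_comb n J f x = vec n (\<lambda>i. \<Sum>j\<in>J. f j * x j $ i)"

lemma lin_comb_carrier [simp]: "lin_comb n J f x \<in> carrier_vec n"
  by (simp add: lin_comb_def)

lemma cscalar_prod_lin_comb_left:
  assumes "z \<in> carrier_vec n"
  shows "lin_comb n J f x \<bullet>c z = (\<Sum>j\<in>J. f j * (x j \<bullet>c z))"
proof -
  have "lin_comb n J f x \<bullet>c z = (\<Sum>i<n. \<Sum>j\<in>J. f j * (x j $ i * cnj (z $ i)))"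
    by (simp add: cscalar_prod_sum[OF assms] lin_comb_def sum_distrib_right mult.assoc)
  also have "\<dots> = (\<Sum>j\<in>J. \<Sum>i<n. f j * (x j $ i * cnj (z $ i)))"
    by (rule sum.swap)
  also have "\<dots> = (\<Sum>j\<in>J. f j * (x j \<bullet>c z))"
    by (simp add: cscalar_prod_sum[OF assms] sum_distrib_left)
  finally show ?thesis .
qed

lemma cscalar_prod_lin_comb_right:
  assumes z: "z \<in> carrier_vec n" and x: "\<And>j. j \<in> J \<Longrightarrow> x j \<in> carrier_vec n"
  shows "z \<bullet>c lin_comb n J f x = (\<Sum>j\<in>J. cnj (f j) * (z \<bullet>c x j))"
proof -
  have "z \<bullet>c lin_comb n J f x = cnj (\<Sum>j\<in>J. f j * (x j \<bullet>c z))"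
    unfolding cscalar_prod_lin_comb_left[OF z, symmetric] by (simp add: cscalar_prod_cnj[OF _ z])
  also have "\<dots> = (\<Sum>j\<in>J. cnj (f j) * (z \<bullet>c x j))"
    using cscalar_prod_cnj[OF x z] by simp
  finally show ?thesis .
qed

lemma mult_mat_lin_comb:
  assumes A: "A \<in> carrier_mat m n" and x: "\<And>j. j \<in> J \<Longrightarrow> x j \<in> carrier_vec n"
  shows "A *\<^sub>v lin_comb n J f x = lin_comb m J f (\<lambda>j. A *\<^sub>v x j)"
proof (rule eq_vecI)
  fix i assume "i < dim_vec (lin_comb m J f (\<lambda>j. A *\<^sub>v x j))"
  then have i: "i < m"
    by (simp add: lin_comb_def)
  have "(A *\<^sub>v lin_comb n J f x) $ i = (\<Sum>l<n. \<Sum>j\<in>J. f j * (A $$ (i, l) * x j $ l))"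
    unfolding mult_mat_vec_index_sum[OF A lin_comb_carrier i]
    by (simp add: lin_comb_def sum_distrib_left mult_ac)
  also have "\<dots> = (\<Sum>j\<in>J. f j * (A *\<^sub>v x j) $ i)"
    by (subst sum.swap)
      (intro sum.cong refl, simp add: mult_mat_vec_index_sum[OF A x i] sum_distrib_left del: index_mult_mat_vec)
  also have "\<dots> = lin_comb m J f (\<lambda>j. A *\<^sub>v x j) $ i"
    using i by (simp add: lin_comb_def)
  finally show "(A *\<^sub>v lin_comb n J f x) $ i = lin_comb m J f (\<lambda>j. A *\<^sub>v x j) $ i" .
qed (use A in \<open>simp add: lin_comb_def\<close>)

text \<open>The orbit of a vector at which \<open>A^k\<close> attains its norm. Nothing is assumed
  about the norms past index \<open>k\<close>; \<open>x (Suc k)\<close> is a vector that turns out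
  to be zero in the extremal case.\<close>

locale isometric_orbit =
  fixes A :: "complex mat" and n k :: nat and x :: "nat \<Rightarrow> complex vec"
  assumes A: "A \<in> carrier_mat n n"
    and contraction: "y \<in> carrier_vec n \<Longrightarrow> l2_norm_vec (A *\<^sub>v y) \<le> l2_norm_vec y"
    and x0: "x 0 \<in> carrier_vec n"
    and x_Suc: "x (Suc j) = A *\<^sub>v x j"
    and x_norm: "j \<le> k \<Longrightarrow> l2_norm_vec (x j) = 1"
begin

abbreviation "c \<equiv> cos (pi / (real k + 2))"
text \<open>The exponents to be compared run from 0 to k + 2, so k + 3 is the smallest order that
  separates them.\<close>

abbreviation "N \<equiv> k + 3"
abbreviation "W \<equiv> (\<Sum>j\<le>k. (fejer k (Suc j))\<^sup>2)"

definition y :: "nat \<Rightarrow> complex vec" where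
  "y s = lin_comb n {..k} (\<lambda>j. of_real (fejer k (Suc j)) * unity_root N s ^ j) x"

lemma x_carrier [simp]: "x j \<in> carrier_vec n"
  using A x0 by (induction j) (auto simp: x_Suc)

lemma y_carrier [simp]: "y s \<in> carrier_vec n"
  by (simp add: y_def)

lemma x_self: "j \<le> k \<Longrightarrow> x j \<bullet>c x j = 1"
  by (simp add: cscalar_prod_self x_norm)

text \<open>For j < k both \<open>x j\<close> and its image have norm 1, so this is the equality
  case of the contraction.\<close>

lemma adjoint_x_Suc: "j < k \<Longrightarrow> mat_adjoint A *\<^sub>v x (Suc j) = x j"
  unfolding x_Suc using A contraction
  by (intro contraction_adjoint_fix[of _ n]) (simp_all add: x_norm flip: x_Suc)

lemma Ay: "A *\<^sub>v y s = lin_comb n {..k} (\<lambda>j. of_real (fejer k (Suc j)) * unity_root N s ^ j) (\<lambda>j. x (Suc j))"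
  by (simp add: y_def mult_mat_lin_comb[OF A] x_Suc)

text \<open>Averages a sesquilinear expansion in the \<open>y s\<close>, whose second argument
  contributes the conjugate powers. The map \<open>p\<close> is the identity for the norm, and
  \<open>Suc\<close> for the quadratic form with its extra root of unity.\<close>

lemma sum_prod_coefficient:
  assumes "\<And>i. i \<le> k \<Longrightarrow> p i < N"
  shows "(\<Sum>s<N. \<Sum>j\<le>k. (\<Sum>i\<le>k. g i j * unity_root N s ^ p i) * cnj (unity_root N s) ^ j)
    = of_nat N * (\<Sum>j\<le>k. \<Sum>i | i \<le> k \<and> p i = j. g i j)"
proof -
  have coeff: "(\<Sum>s<N. (\<Sum>i\<le>k. g i j * unity_root N s ^ p i) * cnj (unity_root N s) ^ j)
      = of_nat N * (\<Sum>i | i \<le> k \<and> p i = j. g i j)" if "j \<le> k" for j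
    using unity_root_coefficient[of "{..k}" j N p "\<lambda>i. g i j"] assms that by (simp only: atMost_iff) simp
  have "(\<Sum>s<N. \<Sum>j\<le>k. (\<Sum>i\<le>k. g i j * unity_root N s ^ p i) * cnj (unity_root N s) ^ j)
      = (\<Sum>j\<le>k. \<Sum>s<N. (\<Sum>i\<le>k. g i j * unity_root N s ^ p i) * cnj (unity_root N s) ^ j)"
    by (rule sum.swap)
  also have "\<dots> = (\<Sum>j\<le>k. of_nat N * (\<Sum>i | i \<le> k \<and> p i = j. g i j))"
    by (intro sum.cong refl coeff) simp
  finally show ?thesis
    unfolding sum_distrib_left .
qed

text \<open>The \<open>x j\<close> are not yet known to be orthogonal; the averaging removes the
  cross terms instead.\<close>

lemma sum_y_self: "(\<Sum>s<N. (l2_norm_vec (y s))\<^sup>2) = real N * W"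
proof -
  have "y s \<bullet>c y s = (\<Sum>j\<le>k. (\<Sum>i\<le>k. (of_real (fejer k (Suc i) * fejer k (Suc j)) * (x i \<bullet>c x j))
      * unity_root N s ^ i) * cnj (unity_root N s) ^ j)" for s
    unfolding y_def by (simp add: cscalar_prod_lin_comb_right cscalar_prod_lin_comb_left[OF x_carrier]
        sum_distrib_left sum_distrib_right mult_ac)
  then have "(\<Sum>s<N. y s \<bullet>c y s)
      = of_nat N * (\<Sum>j\<le>k. \<Sum>i | i \<le> k \<and> i = j. of_real (fejer k (Suc i) * fejer k (Suc j)) * (x i \<bullet>c x j))"
    by (simp only: sum_prod_coefficient[where p = "\<lambda>i. i"])
  also have "(\<Sum>j\<le>k. \<Sum>i | i \<le> k \<and> i = j. of_real (fejer k (Suc i) * fejer k (Suc j)) * (x i \<bullet>c x j)) = of_real W"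
    unfolding of_real_sum
  proof (intro sum.cong refl)
    fix j assume "j \<in> {..k}"
    then have "{i. i \<le> k \<and> i = j} = {j}" "x j \<bullet>c x j = 1"
      by (auto intro: x_self)
    then show "(\<Sum>i | i \<le> k \<and> i = j. of_real (fejer k (Suc i) * fejer k (Suc j)) * (x i \<bullet>c x j))
        = complex_of_real ((fejer k (Suc j))\<^sup>2)"
      by (simp add: power2_eq_square)
  qed
  finally have "of_real (\<Sum>s<N. (l2_norm_vec (y s))\<^sup>2) = complex_of_real (real N * W)"
    by (simp add: cscalar_prod_self)
  then show ?thesis
    by (simp only: of_real_eq_iff)
qed

text \<open>The extra factor matches the exponent at \<open>x (Suc i)\<close> with its index, so
  only pairs with Suc i = j survive, each contributing <x j, x j> = 1.\<close>

lemma sum_Ay_y: "(\<Sum>s<N. unity_root N s * ((A *\<^sub>v y s) \<bullet>c y s)) = of_real (c * (real N * W))"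
proof -
  have "unity_root N s * ((A *\<^sub>v y s) \<bullet>c y s)
      = (\<Sum>j\<le>k. (\<Sum>i\<le>k. (of_real (fejer k (Suc i) * fejer k (Suc j)) * (x (Suc i) \<bullet>c x j))
      * unity_root N s ^ Suc i) * cnj (unity_root N s) ^ j)" for s
    unfolding Ay by (subst y_def)
       (simp add: cscalar_prod_lin_comb_right cscalar_prod_lin_comb_left[OF x_carrier] sum_distrib_left sum_distrib_right mult_ac)
  then have "(\<Sum>s<N. unity_root N s * ((A *\<^sub>v y s) \<bullet>c y s))
      = of_nat N * (\<Sum>j\<le>k. \<Sum>i | i \<le> k \<and> Suc i = j. of_real (fejer k (Suc i) * fejer k (Suc j)) * (x (Suc i) \<bullet>c x j))"
    by (simp only: sum_prod_coefficient[where p = Suc])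
  also have "(\<Sum>j\<le>k. \<Sum>i | i \<le> k \<and> Suc i = j. of_real (fejer k (Suc i) * fejer k (Suc j)) * (x (Suc i) \<bullet>c x j))
      = (\<Sum>j\<le>k. of_real (fejer k j * fejer k (Suc j)))"
  proof (intro sum.cong refl)
    fix j assume "j \<in> {..k}"
    \<comment> \<open>For j = 0 no index survives, in agreement with
      \<open>fejer k 0 = 0\<close>.\<close>
    then have "j = 0 \<and> {i. i \<le> k \<and> Suc i = j} = {} \<or> (\<exists>m. j = Suc m \<and> {i. i \<le> k \<and> Suc i = j} = {m}) \<and> x j \<bullet>c x j = 1"
      by (cases j) (auto intro: x_self)
    then show "(\<Sum>i | i \<le> k \<and> Suc i = j. of_real (fejer k (Suc i) * fejer k (Suc j)) * (x (Suc i) \<bullet>c x j))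
        = complex_of_real (fejer k j * fejer k (Suc j))"
      by auto
  qed
  also have "\<dots> = of_real (\<Sum>j<k. fejer k (Suc j) * fejer k (Suc (Suc j)))"
    by (simp add: sum.atMost_shift)
  finally show ?thesis
    unfolding fejer_sum by (simp add: mult_ac)
qed

section \<open>The lower bound and its extremal case\<close>

lemma lower_bound:
  assumes bound: "\<And>v. v \<in> carrier_vec n \<Longrightarrow> cmod ((A *\<^sub>v v) \<bullet>c v) \<le> w * (l2_norm_vec v)\<^sup>2"
  shows "c \<le> w"
proof -
  \<comment> \<open>The bound is summed over all \<open>y s\<close>; both sides then carry the
    positive factor \<open>real N * W\<close>, which cancels at the end.\<close>
  have "c * (real N * W) = Re (\<Sum>s<N. unity_root N s * ((A *\<^sub>v y s) \<bullet>c y s))"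
    unfolding sum_Ay_y by simp
  also have "\<dots> \<le> (\<Sum>s<N. w * (l2_norm_vec (y s))\<^sup>2)"
    unfolding Re_sum
  proof (rule sum_mono)
    fix s
    have "Re (unity_root N s * ((A *\<^sub>v y s) \<bullet>c y s)) \<le> cmod ((A *\<^sub>v y s) \<bullet>c y s)"
      using complex_Re_le_cmod[of "unity_root N s * ((A *\<^sub>v y s) \<bullet>c y s)"] by (simp add: norm_mult)
    also have "\<dots> \<le> w * (l2_norm_vec (y s))\<^sup>2"
      by (rule bound) simp
    finally show "Re (unity_root N s * ((A *\<^sub>v y s) \<bullet>c y s)) \<le> w * (l2_norm_vec (y s))\<^sup>2" .
  qed
  also have "\<dots> = w * (real N * W)"
    by (simp only: sum_distrib_left[symmetric] sum_y_self)
  finally show ?thesis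
    using fejer_square_sum_pos[of k] by (simp add: mult_le_cancel_right_pos)
qed

text \<open>Comparing the coefficients of \<open>\<omega>\<^sup>k\<^sup>+\<^sup>2\<close> and of \<open>1\<close> in
  \<open>\<omega>\<^sup>2 A y + A\<^sup>* y = 2 c \<omega> y\<close>, where each \<open>y\<close> is a polynomial of degree \<open>k\<close> in \<open>\<omega>\<close>.\<close>

lemma extremal:
  assumes bound: "\<And>v. v \<in> carrier_vec n \<Longrightarrow> cmod ((A *\<^sub>v v) \<bullet>c v) \<le> c * (l2_norm_vec v)\<^sup>2"
  shows "x (Suc k) = 0\<^sub>v n" and "mat_adjoint A *\<^sub>v x 0 = 0\<^sub>v n"
proof -
  let ?A = "mat_adjoint A"
  have A': "?A \<in> carrier_mat n n"
    using A by simp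
  have A'x: "?A *\<^sub>v x j \<in> carrier_vec n" for j
    using A' by (intro mult_mat_vec_carrier[of _ n n]) simp_all
  have le: "Re (unity_root N s * ((A *\<^sub>v v) \<bullet>c v)) \<le> c * (l2_norm_vec v)\<^sup>2" if "v \<in> carrier_vec n" for v s
    using complex_Re_le_cmod[of "unity_root N s * ((A *\<^sub>v v) \<bullet>c v)"] bound[OF that] by (simp add: norm_mult)
  \<comment> \<open>The defects of the \<open>y s\<close> are nonnegative and sum to 0 by the two
    averages, so every \<open>y s\<close> attains the bound.\<close>
  have "(\<Sum>s<N. c * (l2_norm_vec (y s))\<^sup>2 - Re (unity_root N s * ((A *\<^sub>v y s) \<bullet>c y s))) = 0"
    unfolding sum_subtractf Re_sum[symmetric] sum_Ay_y sum_distrib_left[symmetric] sum_y_self by simp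
  then have eq: "Re (unity_root N s * ((A *\<^sub>v y s) \<bullet>c y s)) = c * (l2_norm_vec (y s))\<^sup>2" if "s < N" for s
    using le that by (subst (asm) sum_nonneg_eq_0_iff) auto
  \<comment> \<open>Pairing with a fixed \<open>z\<close> turns the vector identity into one between
    scalar polynomials of degree at most k + 2 at the roots of unity, whose coefficients can be
    compared.\<close>
  have coeff: "(\<Sum>j | j \<le> k \<and> j + 2 = q. of_real (fejer k (Suc j)) * (x (Suc j) \<bullet>c z))
      + (\<Sum>j | j \<le> k \<and> j = q. of_real (fejer k (Suc j)) * ((?A *\<^sub>v x j) \<bullet>c z))
      = 2 * of_real c * (\<Sum>j | j \<le> k \<and> j + 1 = q. of_real (fejer k (Suc j)) * (x j \<bullet>c z))"
    if z: "z \<in> carrier_vec n" and q: "q < N" for z q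
  proof -
    let ?\<omega> = "unity_root N" and ?a = "\<lambda>j. complex_of_real (fejer k (Suc j))"
    have "(\<Sum>j\<le>k. ?a j * (x (Suc j) \<bullet>c z) * ?\<omega> s ^ (j + 2)) + (\<Sum>j\<le>k. ?a j * ((?A *\<^sub>v x j) \<bullet>c z) * ?\<omega> s ^ j)
        = 2 * of_real c * (\<Sum>j\<le>k. ?a j * (x j \<bullet>c z) * ?\<omega> s ^ (j + 1))" if "s < N" for s
    proof -
      \<comment> \<open>Multiplying by the root of unity clears its conjugate and leaves natural
        exponents only.\<close>
      have "?\<omega> s * ?\<omega> s * ((A *\<^sub>v y s) \<bullet>c z) + (?\<omega> s * cnj (?\<omega> s)) * ((?A *\<^sub>v y s) \<bullet>c z)
          = ?\<omega> s * (?\<omega> s * ((A *\<^sub>v y s) \<bullet>c z) + cnj (?\<omega> s) * ((?A *\<^sub>v y s) \<bullet>c z))"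
        by (simp only: ring_distribs mult.assoc)
      also have "\<dots> = ?\<omega> s * (2 * of_real c * (y s \<bullet>c z))"
        by (simp only: numerical_bound_equality[OF A le y_carrier z eq[OF that]])
      finally show ?thesis
        unfolding Ay unfolding y_def mult_mat_lin_comb[OF A' x_carrier] cscalar_prod_lin_comb_left[OF z]
        by (simp add: sum_distrib_left mult_ac)
    qed
    then have "(\<Sum>s<N. (\<Sum>j\<le>k. ?a j * (x (Suc j) \<bullet>c z) * ?\<omega> s ^ (j + 2)) * cnj (?\<omega> s) ^ q)
        + (\<Sum>s<N. (\<Sum>j\<le>k. ?a j * ((?A *\<^sub>v x j) \<bullet>c z) * ?\<omega> s ^ j) * cnj (?\<omega> s) ^ q)
        = 2 * of_real c * (\<Sum>s<N. (\<Sum>j\<le>k. ?a j * (x j \<bullet>c z) * ?\<omega> s ^ (j + 1)) * cnj (?\<omega> s) ^ q)"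
      unfolding sum.distrib[symmetric] ring_distribs(2)[symmetric] sum_distrib_left[of "2 * of_real c"] mult.assoc[symmetric, of "2 * of_real c"]
      by (intro sum.cong refl) simp
    moreover have "(\<Sum>s<N. (\<Sum>j\<le>k. g j * ?\<omega> s ^ p j) * cnj (?\<omega> s) ^ q) = of_nat N * (\<Sum>j | j \<le> k \<and> p j = q. g j)"
      if "\<And>j. j \<le> k \<Longrightarrow> p j < N" for g p
      using unity_root_coefficient[of "{..k}" q N p g] that q by (simp only: atMost_iff finite_atMost)
    ultimately have "of_nat N * ((\<Sum>j | j \<le> k \<and> j + 2 = q. ?a j * (x (Suc j) \<bullet>c z))
      + (\<Sum>j | j \<le> k \<and> j = q. ?a j * ((?A *\<^sub>v x j) \<bullet>c z)))
      = of_nat N * (2 * of_real c * (\<Sum>j | j \<le> k \<and> j + 1 = q. ?a j * (x j \<bullet>c z)))"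
      by (simp only: distrib_left mult.left_commute add_le_mono1 le_imp_less_Suc)
    moreover have "complex_of_nat N \<noteq> 0"
      by (simp only: of_nat_eq_0_iff)
    ultimately show ?thesis
      by (simp only: mult_cancel_left simp_thms)
  qed
  \<comment> \<open>Only the first sum reaches degree k + 2 and only the second has a constant term.
    Each surviving vector is then paired with itself to show that it is zero.\<close>
  have sets: "{j. j \<le> k \<and> j + 2 = k + 2} = {k}" "{j. j \<le> k \<and> j = k + 2} = {}" "{j. j \<le> k \<and> j + 1 = k + 2} = {}"
    "{j. j \<le> k \<and> j + 2 = 0} = {}" "{j. j \<le> k \<and> j = 0} = {0}" "{j. j \<le> k \<and> j + 1 = 0} = {}"
    by auto
  have "of_real (fejer k (Suc k)) * (x (Suc k) \<bullet>c x (Suc k)) = 0"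
    using coeff[of "x (Suc k)" "k + 2"] unfolding sets by simp
  then have "x (Suc k) \<bullet>c x (Suc k) = 0"
    using fejer_pos[of k k] by simp
  then show "x (Suc k) = 0\<^sub>v n"
    using l2_norm_vec_eq_0_iff[OF x_carrier] by (simp add: cscalar_prod_self)
  have "of_real (fejer k (Suc 0)) * ((?A *\<^sub>v x 0) \<bullet>c (?A *\<^sub>v x 0)) = 0"
    using coeff[OF A'x[of 0], of 0] unfolding sets by simp
  then have "(?A *\<^sub>v x 0) \<bullet>c (?A *\<^sub>v x 0) = 0"
    using fejer_pos[of 0 k] by simp
  then show "?A *\<^sub>v x 0 = 0\<^sub>v n"
    using l2_norm_vec_eq_0_iff[OF A'x[of 0]] by (simp add: cscalar_prod_self)
qed

text \<open>Moving \<open>A\<close> across the inner product lowers both indices by one, since the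
  adjoint takes \<open>x (Suc m)\<close> back to \<open>x m\<close>. The descent ends at
  \<open>x 0\<close>, which the adjoint annihilates.\<close>

lemma orthonormal:
  assumes A'x0: "mat_adjoint A *\<^sub>v x 0 = 0\<^sub>v n"
  shows "i \<le> k \<Longrightarrow> j \<le> k \<Longrightarrow> x i \<bullet>c x j = (if i = j then 1 else 0)"
proof -
  have "x 0 \<bullet>c x (Suc j) = 0" for j
  proof -
    have "x (Suc j) \<bullet>c x 0 = x j \<bullet>c 0\<^sub>v n"
      using cscalar_prod_adjoint[OF A x_carrier x_carrier, of j 0] by (simp add: x_Suc A'x0)
    then have "cnj (x (Suc j) \<bullet>c x 0) = 0"
      by (simp add: scalar_prod_right_zero[OF x_carrier])
    then show ?thesis
      by (simp add: cscalar_prod_cnj[OF x_carrier x_carrier])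
  qed
  then have upper: "i < j \<Longrightarrow> j \<le> k \<Longrightarrow> x i \<bullet>c x j = 0" for i j
  proof (induction i arbitrary: j)
    case 0
    then show ?case
      by (cases j) auto
  next
    case (Suc i)
    then obtain m where m: "j = Suc m"
      by (cases j) auto
    have "x (Suc i) \<bullet>c x (Suc m) = x i \<bullet>c x m"
      using Suc.prems cscalar_prod_adjoint[OF A x_carrier x_carrier, of i "Suc m"]
      by (simp add: x_Suc[of i] adjoint_x_Suc m)
    then show ?case
      using Suc m by simp
  qed
  assume "i \<le> k" "j \<le> k"
  then show ?thesis
    using upper[of i j] upper[of j i] cscalar_prod_cnj[OF x_carrier x_carrier, of j i]
    by (cases i j rule: linorder_cases) (auto simp: x_self)
qed

end

section \<open>Unitary similarity and Jordan blocks\<close>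

definition orthonormal_family :: "nat \<Rightarrow> nat \<Rightarrow> (nat \<Rightarrow> complex vec) \<Rightarrow> bool" where
  "orthonormal_family n p u \<longleftrightarrow>
    (\<forall>i<p. u i \<in> carrier_vec n) \<and> (\<forall>i<p. \<forall>j<p. u i \<bullet>c u j = (if i = j then 1 else 0))"

definition mat_of_family :: "nat \<Rightarrow> (nat \<Rightarrow> complex vec) \<Rightarrow> complex mat" where
  "mat_of_family n u = mat n n (\<lambda>(i, j). u j $ i)"

lemma mat_of_family_carrier [simp]: "mat_of_family n u \<in> carrier_mat n n"
  by (simp add: mat_of_family_def)

lemma mat_of_family_unitary:
  assumes u: "orthonormal_family n n u"
  shows "mat_adjoint (mat_of_family n u) * mat_of_family n u = 1\<^sub>m n"
    and "mat_of_family n u * mat_adjoint (mat_of_family n u) = 1\<^sub>m n"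
proof -
  let ?U = "mat_of_family n u"
  show 1: "mat_adjoint ?U * ?U = 1\<^sub>m n"
  proof (rule eq_matI)
    fix i j assume "i < dim_row (1\<^sub>m n :: complex mat)" "j < dim_col (1\<^sub>m n :: complex mat)"
    then have ij: "i < n" "j < n"
      by auto
    have "(mat_adjoint ?U * ?U) $$ (i, j) = (\<Sum>l<n. u j $ l * cnj (u i $ l))"
      using ij by (simp add: scalar_prod_def atLeast0LessThan mat_of_family_def mult.commute)
    also have "\<dots> = u j \<bullet>c u i"
      using u ij by (simp add: cscalar_prod_sum[of _ n] orthonormal_family_def)
    also have "\<dots> = 1\<^sub>m n $$ (i, j)"
      using u ij by (simp add: orthonormal_family_def)
    finally show "(mat_adjoint ?U * ?U) $$ (i, j) = 1\<^sub>m n $$ (i, j)" .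
  qed (simp_all add: mat_of_family_def)
  show "?U * mat_adjoint ?U = 1\<^sub>m n"
    by (rule mat_mult_left_right_inverse[OF _ _ 1]) simp_all
qed

text \<open>If p > n, the first n members are the columns of a unitary U. The next member w is
  orthogonal to all of them, so \<open>U^* w = 0\<close> and \<open>w = U U^* w = 0\<close>,
  although w is a unit vector.\<close>

lemma orthonormal_family_card_le:
  assumes u: "orthonormal_family n p u"
  shows "p \<le> n"
proof (rule ccontr)
  assume "\<not> p \<le> n"
  then have np: "n < p"
    by simp
  let ?U = "mat_of_family n u"
  let ?w = "u n"
  have w: "?w \<in> carrier_vec n" and un: "orthonormal_family n n u"
    using u np by (auto simp: orthonormal_family_def)
  have "mat_adjoint ?U *\<^sub>v ?w = 0\<^sub>v n"
  proof (rule eq_vecI)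
    fix i assume "i < dim_vec (0\<^sub>v n :: complex vec)"
    then have i: "i < n"
      by simp
    have "(mat_adjoint ?U *\<^sub>v ?w) $ i = (\<Sum>l<n. ?w $ l * cnj (u i $ l))"
      unfolding mult_mat_vec_index_sum[OF mat_adjoint_carrier[OF mat_of_family_carrier] w i]
      using i by (simp add: mat_of_family_def mult.commute)
    also have "\<dots> = ?w \<bullet>c u i"
      using u i np by (simp add: cscalar_prod_sum[of _ n] orthonormal_family_def)
    also have "\<dots> = 0"
      using u i np by (simp add: orthonormal_family_def)
    finally show "(mat_adjoint ?U *\<^sub>v ?w) $ i = 0\<^sub>v n $ i"
      using i by simp
  qed (simp add: mat_of_family_def)
  then have "(?U * mat_adjoint ?U) *\<^sub>v ?w = ?U *\<^sub>v 0\<^sub>v n"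
    using w by (simp add: assoc_mult_mat_vec[OF mat_of_family_carrier mat_adjoint_carrier[OF mat_of_family_carrier]])
  then have "?w = ?U *\<^sub>v 0\<^sub>v n"
    using w by (simp add: mat_of_family_unitary[OF un])
  also have "\<dots> = 0\<^sub>v n"
    by (rule eq_vecI) (simp_all add: mat_of_family_def)
  finally have "?w = 0\<^sub>v n" .
  moreover have "?w \<bullet>c ?w = 1"
    using u np by (simp add: orthonormal_family_def)
  ultimately show False
    by simp
qed

text \<open>Orthogonality to fewer than n vectors is a homogeneous system whose square matrix can be
  given a zero row; its determinant vanishes, and a kernel vector is normalised.\<close>

lemma ex_unit_vector_orthogonal:
  fixes u :: "nat \<Rightarrow> complex vec"
  assumes p: "p < n" and u: "\<And>i. i < p \<Longrightarrow> u i \<in> carrier_vec n"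
  obtains v where "v \<in> carrier_vec n" "v \<bullet>c v = 1" "\<And>i. i < p \<Longrightarrow> v \<bullet>c u i = 0"
proof -
  define r where "r i = (if i < p then conjugate (u i) else 0\<^sub>v n)" for i
  \<comment> \<open>As p < n, the row n - 1 of \<open>r\<close> is zero anyway; the case distinction
    displays it in the shape that \<open>det_row_0\<close> expects.\<close>
  define M where "M = mat\<^sub>r n n (\<lambda>i. if i = n - 1 then 0\<^sub>v n else r i)"
  have M: "M \<in> carrier_mat n n"
    by (simp add: M_def)
  have "det M = 0"
    unfolding M_def using p u by (intro det_row_0) (auto simp: r_def)
  then obtain v where v: "v \<in> carrier_vec n" "v \<noteq> 0\<^sub>v n" "M *\<^sub>v v = 0\<^sub>v n"
    using det_0_iff_vec_prod_zero[OF M] by blast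
  have orth: "v \<bullet>c u i = 0" if i: "i < p" for i
  proof (cases "i = n - 1")
    case True
    then show ?thesis
      using i p by simp
  next
    case False
    have "(M *\<^sub>v v) $ i = conjugate (u i) \<bullet> v"
      using False i p u by (simp add: M_def r_def)
    then show ?thesis
      using v i p u comm_scalar_prod[of v n "conjugate (u i)"] by simp
  qed
  define a where "a = complex_of_real (1 / l2_norm_vec v)"
  have v0: "l2_norm_vec v \<noteq> 0"
    using v by (simp add: l2_norm_vec_eq_0_iff)
  show ?thesis
  proof
    show "a \<cdot>\<^sub>v v \<in> carrier_vec n"
      using v by simp
    have "l2_norm_vec (a \<cdot>\<^sub>v v) = 1"
      using v0 by (simp add: l2_norm_vec_smult a_def norm_divide)
    then show "(a \<cdot>\<^sub>v v) \<bullet>c (a \<cdot>\<^sub>v v) = 1"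
      by (simp add: cscalar_prod_self)
    show "(a \<cdot>\<^sub>v v) \<bullet>c u i = 0" if "i < p" for i
      using cscalar_prod_smult_left[OF v(1) u[OF that]] orth[OF that] by simp
  qed
qed

text \<open>Induction downwards from p = n, adjoining one orthogonal unit vector per step.\<close>

lemma orthonormal_family_extend:
  assumes "orthonormal_family n p u" "p \<le> n"
  obtains v where "orthonormal_family n n v" "\<And>i. i < p \<Longrightarrow> v i = u i"
proof -
  have "\<exists>v. orthonormal_family n n v \<and> (\<forall>i<p. v i = u i)"
    using assms(2,1)
  proof (induction p arbitrary: u rule: inc_induct)
    case base
    then show ?case
      by blast
  next
    case (step p)
    have car: "\<And>i. i < p \<Longrightarrow> u i \<in> carrier_vec n"
      using step.prems by (simp add: orthonormal_family_def)
    obtain w where w: "w \<in> carrier_vec n" "w \<bullet>c w = 1" "\<And>i. i < p \<Longrightarrow> w \<bullet>c u i = 0"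
      using ex_unit_vector_orthogonal[of p n u, OF step.hyps(2) car] by metis
    have w': "u i \<bullet>c w = 0" if "i < p" for i
      using cscalar_prod_cnj[OF w(1) car[OF that]] w(3)[OF that] by simp
    have "orthonormal_family n (Suc p) (u(p := w))"
      using step.prems w w' by (auto simp: orthonormal_family_def less_Suc_eq)
    from step.IH[OF this] obtain v where "orthonormal_family n n v" "\<forall>i<Suc p. v i = (u(p := w)) i"
      by blast
    then show ?case
      by (intro exI[of _ v]) auto
  qed
  then show ?thesis
    using that by blast
qed

section \<open>Unitary invariance of the numerical range\<close>

lemma mat_adjoint_adjoint [simp]: "mat_adjoint (mat_adjoint A) = (A :: complex mat)"
  by (rule eq_matI) auto

lemma unitarily_similar_sym:
  assumes "unitarily_similar A B"
  shows "unitarily_similar B A"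
proof -
  obtain U where "similar_mat_wit A B U (mat_adjoint U)"
    using assms by (auto simp: unitarily_similar_def)
  then have "similar_mat_wit B A (mat_adjoint U) (mat_adjoint (mat_adjoint U))"
    by (simp add: similar_mat_wit_sym)
  then show ?thesis
    unfolding unitarily_similar_def by blast
qed

text \<open>The isometry \<open>U\<close> carries a unit vector for \<open>B\<close> to a unit
  vector for \<open>A\<close> with the same value of the quadratic form. The other inclusion will
  follow by symmetry.\<close>

lemma numerical_range_unitarily_similar_subset:
  assumes A: "A \<in> carrier_mat n n" and sim: "unitarily_similar A B"
  shows "numerical_range B \<subseteq> numerical_range A"
proof
  obtain U where "similar_mat_wit A B U (mat_adjoint U)"
    using sim by (auto simp: unitarily_similar_def)
  note U = similar_mat_witD2[OF A this]
  fix z assume "z \<in> numerical_range B"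
  then obtain w where w: "w \<in> carrier_vec n" "l2_norm_vec w = 1" and z: "z = (B *\<^sub>v w) \<bullet>c w"
    using U(5) by (auto simp: numerical_range_def)
  have Uw: "U *\<^sub>v w \<in> carrier_vec n" and Bw: "B *\<^sub>v w \<in> carrier_vec n"
    using U w by auto
  have iso: "(U *\<^sub>v v) \<bullet>c (U *\<^sub>v w) = v \<bullet>c w" if v: "v \<in> carrier_vec n" for v
    using cscalar_prod_adjoint[OF U(6) v Uw] U w
      assoc_mult_mat_vec[OF U(7) U(6) w(1)] by simp
  have "mat_adjoint U *\<^sub>v (U *\<^sub>v w) = w"
    using assoc_mult_mat_vec[OF U(7) U(6) w(1)] U(2) w(1) by simp
  then have "A *\<^sub>v (U *\<^sub>v w) = U *\<^sub>v (B *\<^sub>v w)"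
    by (simp only: U(3) assoc_mult_mat_vec[OF mult_carrier_mat[OF U(6) U(5)] U(7) Uw]
        assoc_mult_mat_vec[OF U(6) U(5) w(1)])
  then have "(A *\<^sub>v (U *\<^sub>v w)) \<bullet>c (U *\<^sub>v w) = z"
    using iso[OF Bw] z by simp
  moreover have "l2_norm_vec (U *\<^sub>v w) = 1"
    using iso[OF w(1)] w(2) by (simp add: l2_norm_vec_def)
  ultimately show "z \<in> numerical_range A"
    using A Uw by (auto simp: numerical_range_def intro!: exI[of _ "U *\<^sub>v w"])
qed

lemma numerical_range_unitarily_similar:
  assumes A: "A \<in> carrier_mat n n" and sim: "unitarily_similar A B"
  shows "numerical_range A = numerical_range B"
proof -
  have "B \<in> carrier_mat n n"
    using sim similar_mat_witD2[OF A] by (auto simp: unitarily_similar_def)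
  then show ?thesis
    using numerical_range_unitarily_similar_subset[OF A sim]
      numerical_range_unitarily_similar_subset[OF _ unitarily_similar_sym[OF sim]] by blast
qed

section \<open>Direct sums of two blocks\<close>

text \<open>The recursion of \<open>diag_block_mat\<close> ends with an empty block, which is
  absorbed here.\<close>

lemma diag_block_mat_pair:
  assumes "A \<in> carrier_mat n n" "B \<in> carrier_mat m m"
  shows "diag_block_mat [A, B] = four_block_mat A (0\<^sub>m n m) (0\<^sub>m m n) B"
proof -
  have "four_block_mat B (0\<^sub>m m 0) (0\<^sub>m 0 m) (0\<^sub>m 0 0) = B"
    using assms by (intro eq_matI) auto
  then show ?thesis
    using assms by simp
qed

lemma diag_block_quadratic_form:
  fixes A B :: "complex mat"
  assumes A: "A \<in> carrier_mat n n" and B: "B \<in> carrier_mat m m"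
    and a: "a \<in> carrier_vec n" and b: "b \<in> carrier_vec m"
  shows "(diag_block_mat [A, B] *\<^sub>v (a @\<^sub>v b)) \<bullet>c (a @\<^sub>v b) = (A *\<^sub>v a) \<bullet>c a + (B *\<^sub>v b) \<bullet>c b"
proof -
  have "conjugate (a @\<^sub>v b) = conjugate a @\<^sub>v conjugate b"
    by (rule eq_vecI) (auto)
  then show ?thesis
    unfolding diag_block_mat_pair[OF A B] mult_mat_vec_split[OF A B a b]
    using A B a b by (simp add: scalar_prod_append[of _ n _ m] mult_mat_vec_carrier[OF A] mult_mat_vec_carrier[OF B])
qed

lemma l2_norm_vec_append:
  "(l2_norm_vec (a @\<^sub>v b))\<^sup>2 = (l2_norm_vec a)\<^sup>2 + (l2_norm_vec b)\<^sup>2"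
proof -
  have "conjugate (a @\<^sub>v b) = conjugate a @\<^sub>v conjugate b"
    by (rule eq_vecI) auto
  then have "(a @\<^sub>v b) \<bullet>c (a @\<^sub>v b) = a \<bullet>c a + b \<bullet>c b"
    by (simp add: scalar_prod_append[OF carrier_vec_dim_vec carrier_vec_dim_vec])
  then have "complex_of_real ((l2_norm_vec (a @\<^sub>v b))\<^sup>2) = of_real ((l2_norm_vec a)\<^sup>2 + (l2_norm_vec b)\<^sup>2)"
    unfolding cscalar_prod_self by simp
  then show ?thesis
    by (simp only: of_real_eq_iff)
qed

text \<open>A unit vector for one block, padded with zeros, gives the same value for the
  sum.\<close>

lemma numerical_range_subset_diag_block:
  fixes A B :: "complex mat"
  assumes A: "A \<in> carrier_mat n n" and B: "B \<in> carrier_mat m m"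
  shows "numerical_range A \<subseteq> numerical_range (diag_block_mat [A, B])"
    and "numerical_range B \<subseteq> numerical_range (diag_block_mat [A, B])"
proof -
  have D: "dim_col (diag_block_mat [A, B]) = n + m"
    using A B by (simp add: diag_block_mat_pair[OF A B])
  have zA: "A *\<^sub>v 0\<^sub>v n = 0\<^sub>v n" and zB: "B *\<^sub>v 0\<^sub>v m = 0\<^sub>v m"
    using A B by auto
  show "numerical_range A \<subseteq> numerical_range (diag_block_mat [A, B])"
  proof
    fix z assume "z \<in> numerical_range A"
    then obtain a where a: "a \<in> carrier_vec n" "l2_norm_vec a = 1" "z = (A *\<^sub>v a) \<bullet>c a"
      using A by (auto simp: numerical_range_def)
    have "(l2_norm_vec (a @\<^sub>v 0\<^sub>v m))\<^sup>2 = 1"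
      unfolding l2_norm_vec_append using a by (simp add: l2_norm_vec_eq_0_iff[of _ m, THEN iffD2])
    then have "l2_norm_vec (a @\<^sub>v 0\<^sub>v m) = 1"
      by (metis abs_1 abs_of_nonneg l2_norm_vec_nonneg power2_eq_1_iff one_neq_neg_one abs_neg_one)
    moreover have "(diag_block_mat [A, B] *\<^sub>v (a @\<^sub>v 0\<^sub>v m)) \<bullet>c (a @\<^sub>v 0\<^sub>v m) = z"
      using diag_block_quadratic_form[OF A B a(1) zero_carrier_vec] a(3) by (simp add: zB)
    ultimately show "z \<in> numerical_range (diag_block_mat [A, B])"
      using a(1) unfolding numerical_range_def D by (auto intro!: exI[of _ "a @\<^sub>v 0\<^sub>v m"])
  qed
  show "numerical_range B \<subseteq> numerical_range (diag_block_mat [A, B])"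
  proof
    fix z assume "z \<in> numerical_range B"
    then obtain b where b: "b \<in> carrier_vec m" "l2_norm_vec b = 1" "z = (B *\<^sub>v b) \<bullet>c b"
      using B by (auto simp: numerical_range_def)
    have "(l2_norm_vec (0\<^sub>v n @\<^sub>v b))\<^sup>2 = 1"
      unfolding l2_norm_vec_append using b by (simp add: l2_norm_vec_eq_0_iff[of _ n, THEN iffD2])
    then have "l2_norm_vec (0\<^sub>v n @\<^sub>v b) = 1"
      by (metis abs_1 abs_of_nonneg l2_norm_vec_nonneg power2_eq_1_iff one_neq_neg_one abs_neg_one)
    moreover have "(diag_block_mat [A, B] *\<^sub>v (0\<^sub>v n @\<^sub>v b)) \<bullet>c (0\<^sub>v n @\<^sub>v b) = z"
      using diag_block_quadratic_form[OF A B zero_carrier_vec b(1)] b(3) by (simp add: zA)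
    ultimately show "z \<in> numerical_range (diag_block_mat [A, B])"
      using b(1) unfolding numerical_range_def D by (auto intro!: exI[of _ "0\<^sub>v n @\<^sub>v b"])
  qed
qed

section \<open>Numerical range of the nilpotent Jordan block\<close>

lemma jordan_block_quadratic_form:
  fixes a :: "complex vec"
  assumes a: "a \<in> carrier_vec (Suc k)"
  shows "(jordan_block (Suc k) 0 *\<^sub>v a) \<bullet>c a = (\<Sum>i<k. a $ Suc i * cnj (a $ i))"
proof -
  have "(jordan_block (Suc k) 0 *\<^sub>v a) $ i = (if i < k then a $ Suc i else 0)" if "i < Suc k" for i
  proof -
    have "(jordan_block (Suc k) 0 *\<^sub>v a) $ i = (\<Sum>j<Suc k. if j = Suc i then a $ j else 0)"
      unfolding mult_mat_vec_index_sum[OF jordan_block_carrier a that] using that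
      by (intro sum.cong refl) auto
    then show ?thesis
      using that by simp
  qed
  then show ?thesis
    unfolding cscalar_prod_sum[OF a] by simp
qed

text \<open>Passing to the moduli of the coordinates reduces this to the real
  \<open>fejer_inequality\<close>.\<close>

lemma jordan_block_norm_quadratic_form_le:
  assumes a: "a \<in> carrier_vec (Suc k)"
  shows "cmod ((jordan_block (Suc k) 0 *\<^sub>v a) \<bullet>c a) \<le> cos (pi / (real k + 2)) * (l2_norm_vec a)\<^sup>2"
proof -
  have "cmod ((jordan_block (Suc k) 0 *\<^sub>v a) \<bullet>c a) \<le> (\<Sum>i<k. cmod (a $ i) * cmod (a $ Suc i))"
    unfolding jordan_block_quadratic_form[OF a] by (rule sum_norm_le) (simp add: norm_mult)
  also have "\<dots> \<le> cos (pi / (real k + 2)) * (\<Sum>i\<le>k. (cmod (a $ i))\<^sup>2)"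
    by (rule fejer_inequality)
  finally show ?thesis
    unfolding l2_norm_vec_sq[OF a] lessThan_Suc_atMost .
qed

text \<open>Modulus and argument are reached separately: real weights deformed from a multiple of
  the first basis vector to the Fejer vector give every modulus by continuity, and phases that turn
  by a constant factor per coordinate give the argument.\<close>

lemma disc_subset_numerical_range_jordan_block:
  assumes z: "cmod z \<le> cos (pi / (real k + 2))"
  shows "z \<in> numerical_range (jordan_block (Suc k) 0)"
proof -
  let ?S = "fejer k"
  \<comment> \<open>The first weight stays fixed, so the vector never vanishes on the way and the
    quotient \<open>f\<close> below is continuous.\<close>
  define b where "b t i = (if i = 0 then ?S 1 else t * ?S (Suc i))" for t :: real and i
  define q where "q t = (\<Sum>i\<le>k. (b t i)\<^sup>2)" for t
  define f where "f t = (\<Sum>i<k. b t i * b t (Suc i)) / q t" for t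
  have q_pos: "0 < q t" for t
  proof -
    have "0 < (b t 0)\<^sup>2"
      using fejer_pos[of 0 k] by (simp add: b_def)
    also have "\<dots> \<le> q t"
      unfolding q_def by (intro member_le_sum) auto
    finally show ?thesis .
  qed
  have b_cont: "continuous_on {0..1} (\<lambda>t. b t i)" for i
    by (cases "i = 0") (auto simp: b_def intro!: continuous_intros)
  have "continuous_on {0..1} q"
    unfolding q_def by (intro continuous_intros b_cont)
  then have "continuous_on {0..1} f"
    unfolding f_def using q_pos by (intro continuous_intros b_cont) (auto simp: less_le)
  moreover have "f 0 = 0"
    by (simp add: f_def b_def)
  moreover have "f 1 = cos (pi / (real k + 2))"
  proof -
    have b1: "b 1 = (\<lambda>i. ?S (Suc i))"
      by (auto simp: b_def)
    show ?thesis
      using fejer_square_sum_pos[of k] by (simp add: f_def q_def b1 fejer_sum)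
  qed
  ultimately obtain t where t: "f t = cmod z"
    using IVT'[of f 0 "cmod z" 1] z by auto
  define r where "r = sqrt (q t)"
  have r: "0 < r" "r\<^sup>2 = q t"
    using q_pos[of t] by (simp_all add: r_def)
  define \<omega> where "\<omega> = cis (Arg z)"
  have z_eq: "z = \<omega> * of_real (cmod z)"
    using rcis_cmod_Arg[of z] by (simp add: \<omega>_def rcis_def mult.commute)
  have \<omega>: "cmod \<omega> = 1" "\<omega> * cnj \<omega> = 1"
    by (simp_all add: \<omega>_def cis_cnj cis_mult)
  define a where "a = vec (Suc k) (\<lambda>i. of_real (b t i / r) * \<omega> ^ i)"
  have a: "a \<in> carrier_vec (Suc k)"
    by (simp add: a_def)
  have "(l2_norm_vec a)\<^sup>2 = (\<Sum>i\<le>k. (b t i)\<^sup>2 / r\<^sup>2)"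
    unfolding l2_norm_vec_sq[OF a] lessThan_Suc_atMost
    by (intro sum.cong refl) (simp add: a_def norm_mult norm_divide norm_power \<omega> power_divide)
  also have "\<dots> = 1"
    using q_pos[of t] by (simp add: sum_divide_distrib[symmetric] r(2) q_def[symmetric])
  finally have a1: "l2_norm_vec a = 1"
    by (metis abs_1 abs_of_nonneg l2_norm_vec_nonneg power2_eq_1_iff one_neq_neg_one abs_neg_one)
  have \<omega>_power: "\<omega> ^ Suc i * cnj (\<omega> ^ i) = \<omega>" for i
    using \<omega>(2) by (simp add: power_mult_distrib[symmetric] mult.assoc)
  have "a $ Suc i * cnj (a $ i) = of_real (b t i * b t (Suc i) / r\<^sup>2) * (\<omega> ^ Suc i * cnj (\<omega> ^ i))" if "i < k" for i
    using that by (simp add: a_def power2_eq_square)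
  then have "(\<Sum>i<k. a $ Suc i * cnj (a $ i)) = (\<Sum>i<k. of_real (b t i * b t (Suc i)) / of_real (q t) * \<omega>)"
    unfolding \<omega>_power r(2) by (intro sum.cong refl) simp
  also have "\<dots> = \<omega> * of_real (f t)"
    by (simp add: f_def sum_divide_distrib sum_distrib_left mult.commute)
  finally have "(jordan_block (Suc k) 0 *\<^sub>v a) \<bullet>c a = z"
    unfolding jordan_block_quadratic_form[OF a] t using z_eq by simp
  then show ?thesis
    using a a1 by (auto simp: numerical_range_def intro!: exI[of _ a])
qed

text \<open>The Jordan block alone fills the disc; splitting a vector along the blocks shows that
  \<open>B\<close> adds nothing outside it.\<close>

lemma numerical_range_jordan_block_sum:
  assumes B: "B \<in> carrier_mat m m" and le: "0 < m \<longrightarrow> numerical_radius B \<le> cos (pi / (real k + 2))"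
  shows "numerical_range (diag_block_mat [jordan_block (Suc k) 0, B]) = {z. cmod z \<le> cos (pi / (real k + 2))}"
proof
  let ?c = "cos (pi / (real k + 2))" and ?J = "jordan_block (Suc k) 0 :: complex mat"
  let ?D = "diag_block_mat [?J, B]"
  have D: "dim_col ?D = Suc k + m"
    using B by (simp add: diag_block_mat_pair[OF jordan_block_carrier B])
  show "{z. cmod z \<le> ?c} \<subseteq> numerical_range ?D"
    using disc_subset_numerical_range_jordan_block numerical_range_subset_diag_block(1)[OF jordan_block_carrier B]
    by blast
  show "numerical_range ?D \<subseteq> {z. cmod z \<le> ?c}"
  proof
    fix z assume "z \<in> numerical_range ?D"
    then obtain v where v: "v \<in> carrier_vec (Suc k + m)" "l2_norm_vec v = 1" "z = (?D *\<^sub>v v) \<bullet>c v"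
      unfolding numerical_range_def D by blast
    define a where "a = vec_first v (Suc k)"
    define b where "b = vec_last v m"
    have ab: "v = a @\<^sub>v b" "a \<in> carrier_vec (Suc k)" "b \<in> carrier_vec m"
      using v(1) by (simp_all add: a_def b_def)
    \<comment> \<open>For m = 0 the hypothesis on \<open>B\<close> is void, but then
      \<open>b\<close> is the empty vector and both sides are 0.\<close>
    have Bb: "cmod ((B *\<^sub>v b) \<bullet>c b) \<le> ?c * (l2_norm_vec b)\<^sup>2"
    proof (cases "m = 0")
      case True
      then show ?thesis
        using ab B by (simp add: scalar_prod_def l2_norm_vec_sq[OF ab(3)])
    next
      case False
      then have "numerical_radius B * (l2_norm_vec b)\<^sup>2 \<le> ?c * (l2_norm_vec b)\<^sup>2"
        using le by (intro mult_right_mono) auto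
      then show ?thesis
        using norm_cscalar_prod_le_numerical_radius[OF B ab(3)] by linarith
    qed
    have "cmod z \<le> cmod ((?J *\<^sub>v a) \<bullet>c a) + cmod ((B *\<^sub>v b) \<bullet>c b)"
      unfolding v(3) ab(1) diag_block_quadratic_form[OF jordan_block_carrier B ab(2,3)] by (rule norm_triangle_ineq)
    also have "\<dots> \<le> ?c * (l2_norm_vec a)\<^sup>2 + ?c * (l2_norm_vec b)\<^sup>2"
      by (intro add_mono jordan_block_norm_quadratic_form_le ab Bb)
    also have "\<dots> = ?c * (l2_norm_vec v)\<^sup>2"
      unfolding ab(1) l2_norm_vec_append by (simp add: distrib_left)
    finally show "z \<in> {z. cmod z \<le> ?c}"
      using v(2) by simp
  qed
qed

section \<open>Splitting off the Jordan block as a reducing part\<close>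

context isometric_orbit
begin

lemma unitarily_similar_jordan_block_sum:
  assumes xk: "x (Suc k) = 0\<^sub>v n" and A'x0: "mat_adjoint A *\<^sub>v x 0 = 0\<^sub>v n"
  obtains m B where "n = k + 1 + m" "B \<in> carrier_mat m m"
    "unitarily_similar A (diag_block_mat [jordan_block (k + 1) 0, B])"
proof -
  \<comment> \<open>The orbit is listed backwards, because ones above the diagonal require each
    basis vector to be mapped to its predecessor.\<close>
  have fam: "orthonormal_family n (Suc k) (\<lambda>j. x (k - j))"
    using orthonormal[OF A'x0] by (auto simp: orthonormal_family_def)
  obtain v where v: "orthonormal_family n n v" and vx: "\<And>j. j < Suc k \<Longrightarrow> v j = x (k - j)"
    using orthonormal_family_extend[OF fam orthonormal_family_card_le[OF fam]] by blast
  have v_car: "v j \<in> carrier_vec n" if "j < n" for j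
    using v that by (simp add: orthonormal_family_def)
  have vv: "v i \<bullet>c v j = (if i = j then 1 else 0)" if "i < n" "j < n" for i j
    using v that by (simp add: orthonormal_family_def)
  define m where "m = n - Suc k"
  have n: "n = Suc k + m"
    using orthonormal_family_card_le[OF fam] by (simp add: m_def)
  define U where "U = mat_of_family n v"
  have U: "U \<in> carrier_mat n n" "mat_adjoint U * U = 1\<^sub>m n" "U * mat_adjoint U = 1\<^sub>m n"
    using mat_of_family_unitary[OF v] by (simp_all add: U_def)
  have U': "mat_adjoint U \<in> carrier_mat n n"
    using U(1) by simp
  define D where "D = mat_adjoint U * A * U"
  have D: "D \<in> carrier_mat n n"
    using U A by (auto simp: D_def intro!: mult_carrier_mat[of _ n n])
  have A_eq: "A = U * D * mat_adjoint U"
  proof -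
    have "U * D * mat_adjoint U = (U * mat_adjoint U) * A * (U * mat_adjoint U)"
      using U(1) U' A by (simp add: D_def assoc_mult_mat[of _ n n _ n _ n] mult_carrier_mat[of _ n n _ n])
    then show ?thesis
      using A by (simp add: U)
  qed
  have D_index: "D $$ (i, j) = (A *\<^sub>v v j) \<bullet>c v i" if i: "i < n" and j: "j < n" for i j
  proof -
    have Av: "A *\<^sub>v v j \<in> carrier_vec n"
      using A v_car[OF j] by auto
    have "col U j = v j"
      using v_car[OF j] j by (intro eq_vecI) (auto simp: U_def mat_of_family_def)
    then have "col (A * U) j = A *\<^sub>v v j"
      unfolding col_mult2[OF A U(1) j] by (rule arg_cong)
    moreover have "row (mat_adjoint U) i = conjugate (v i)"
      using v_car[OF i] i U(1) by (intro eq_vecI) (auto simp: U_def mat_of_family_def)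
    moreover have "D = mat_adjoint U * (A * U)"
      using U(1) U' A by (simp add: D_def assoc_mult_mat[of _ n n _ n _ n])
    ultimately have "D $$ (i, j) = conjugate (v i) \<bullet> (A *\<^sub>v v j)"
      using i j U(1) A by simp
    then show ?thesis
      using Av v_car[OF i] comm_scalar_prod[of "conjugate (v i)" n] by simp
  qed
  \<comment> \<open>The first k + 1 columns over all rows: the span of the orbit is invariant under
    \<open>A\<close>, so the lower left block is zero as well.\<close>
  have left: "D $$ (i, j) = (if Suc i = j then 1 else 0)" if j: "j \<le> k" and i: "i < n" for i j
  proof (cases j)
    case 0
    then have "A *\<^sub>v v j = 0\<^sub>v n"
      using vx[of 0] xk by (simp add: x_Suc)
    then show ?thesis
      using D_index[of i j] i n 0 v_car[OF i] by simp
  next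
    case (Suc l)
    then have "A *\<^sub>v v j = v l"
      using j vx[of j] vx[of l] x_Suc[of "k - Suc l"] Suc_diff_Suc[of l k] by simp
    then show ?thesis
      using D_index[of i j] vv[of l i] i j n Suc by auto
  qed
  \<comment> \<open>The upper right block vanishes because the span of the orbit is also invariant
    under the adjoint.\<close>
  have right: "D $$ (i, j) = 0" if i: "i \<le> k" and j: "k < j" "j < n" for i j
  proof -
    have "(A *\<^sub>v v j) \<bullet>c v i = v j \<bullet>c (mat_adjoint A *\<^sub>v v i)"
      using i n j by (intro cscalar_prod_adjoint[OF A] v_car) auto
    also have "\<dots> = 0"
    proof (cases "i = k")
      case True
      then show ?thesis
        using vx[of k] A'x0 v_car[OF j(2)] by simp
    next
      case False
      then have "mat_adjoint A *\<^sub>v v i = v (Suc i)"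
        using i vx[of i] vx[of "Suc i"] adjoint_x_Suc[of "k - Suc i"] Suc_diff_Suc[of i k] by simp
      then show ?thesis
        using vv[of j "Suc i"] i j False by simp
    qed
    finally show ?thesis
      using D_index[of i j] i j n by simp
  qed
  define B where "B = mat m m (\<lambda>(i, j). D $$ (i + Suc k, j + Suc k))"
  have B: "B \<in> carrier_mat m m"
    by (simp add: B_def)
  have "D = diag_block_mat [jordan_block (k + 1) 0, B]"
    unfolding diag_block_mat_pair[OF jordan_block_carrier B]
  proof (rule eq_matI)
    fix i j assume "i < dim_row (four_block_mat (jordan_block (k + 1) (0 :: complex)) (0\<^sub>m (k + 1) m) (0\<^sub>m m (k + 1)) B)"
      "j < dim_col (four_block_mat (jordan_block (k + 1) (0 :: complex)) (0\<^sub>m (k + 1) m) (0\<^sub>m m (k + 1)) B)"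
    then have ij: "i < n" "j < n"
      using B n by (simp_all add: jordan_block_def)
    then show "D $$ (i, j) = four_block_mat (jordan_block (k + 1) 0) (0\<^sub>m (k + 1) m) (0\<^sub>m m (k + 1)) B $$ (i, j)"
      using n left[of j i] right[of i j] by (auto simp: B_def jordan_block_def not_less)
  qed (use D n in \<open>simp_all add: B_def jordan_block_def\<close>)
  moreover have "unitarily_similar A D"
    unfolding unitarily_similar_def
    using similar_mat_witI[OF U(3) U(2) A_eq A D U(1) U'] by blast
  ultimately show ?thesis
    using that[of m B] n B by simp
qed

end

section \<open>Comparison of radii, existence of the orbit, and the equivalences\<close>

lemma numerical_radius_mono:
  assumes "A \<in> carrier_mat n n" "B \<in> carrier_mat m m" "0 < m" "numerical_range B \<subseteq> numerical_range A"
  shows "numerical_radius B \<le> numerical_radius A"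
  unfolding numerical_radius_def using assms numerical_range_nonempty[OF assms(2,3)]
  by (intro cSup_subset_mono bdd_above_numerical_range[OF assms(1)]) auto

lemma numerical_radius_disc:
  assumes "numerical_range A = {z. cmod z \<le> r}" "0 \<le> r"
  shows "numerical_radius A = r"
  unfolding numerical_radius_def assms(1)
  by (rule cSup_eq_maximum) (use assms(2) in \<open>auto intro!: image_eqI[of _ _ "of_real r"]\<close>)

text \<open>Start at a vector of the unit ball where \<open>A^k\<close> attains its norm 1. The
  norms decrease along the orbit and are squeezed between 1 at index \<open>k\<close> and at most 1
  at index 0.\<close>

lemma isometric_orbit_exists:
  assumes A: "A \<in> carrier_mat n n" and norm_A: "op_norm A = 1" and norm_Ak: "op_norm (A ^\<^sub>m k) = 1"
  obtains x where "isometric_orbit A n k x"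
proof -
  have contr: "l2_norm_vec (A *\<^sub>v v) \<le> l2_norm_vec v" if "v \<in> carrier_vec n" for v
    using op_norm_attained[OF A] that norm_A by (metis mult_1)
  obtain x0 where x0: "x0 \<in> carrier_vec n" "l2_norm_vec x0 \<le> 1" "l2_norm_vec (A ^\<^sub>m k *\<^sub>v x0) = 1"
    using op_norm_attained[OF pow_carrier_mat[OF A]] norm_Ak by metis
  define x where "x j = ((*\<^sub>v) A ^^ j) x0" for j
  have x_Suc: "x (Suc j) = A *\<^sub>v x j" for j
    by (simp add: x_def)
  have x_car: "x j \<in> carrier_vec n" for j
    using A x0(1) by (induction j) (auto simp: x_Suc, simp add: x_def)
  \<comment> \<open>The matrix power multiplies by \<open>A\<close> on the right, so the induction
    replaces \<open>v\<close> by its image and must keep \<open>v\<close> arbitrary.\<close>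
  have "A ^\<^sub>m j *\<^sub>v v = ((*\<^sub>v) A ^^ j) v" if "v \<in> carrier_vec n" for j v
    using that
  proof (induction j arbitrary: v)
    case 0
    then show ?case
      using A by simp
  next
    case (Suc j)
    then have "A ^\<^sub>m Suc j *\<^sub>v v = A ^\<^sub>m j *\<^sub>v (A *\<^sub>v v)"
      using A by (simp add: assoc_mult_mat_vec[of _ n n _ n])
    also have "\<dots> = ((*\<^sub>v) A ^^ j) (A *\<^sub>v v)"
      using A Suc.prems by (intro Suc.IH) auto
    finally show ?case
      by (simp add: funpow_swap1)
  qed
  then have xk: "l2_norm_vec (x k) = 1"
    using x0 by (simp add: x_def)
  have anti: "l2_norm_vec (x j) \<le> l2_norm_vec (x i)" if "i \<le> j" for i j
    by (rule lift_Suc_antimono_le[of "\<lambda>i. l2_norm_vec (x i)", OF _ that]) (simp add: x_Suc contr x_car)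
  have "l2_norm_vec (x j) = 1" if "j \<le> k" for j
    using anti[OF that] anti[of 0 j] xk x0(2) by (simp add: x_def)
  then have "isometric_orbit A n k x"
    using A contr x_car x_Suc by unfold_locales auto
  then show ?thesis
    by (rule that)
qed

theorem theorem2p10:
  fixes A :: "complex mat" and n k :: nat
  assumes "k \<ge> 1"
    and "A \<in> carrier_mat n n"
    and "op_norm A = 1"
    and "op_norm (A ^\<^sub>m k) = 1"
  shows "numerical_radius A \<ge> cos (pi / (real k + 2)) \<and>
    (numerical_radius A = cos (pi / (real k + 2)) \<longleftrightarrow>
      (\<exists>m B. n = k + 1 + m \<and> B \<in> carrier_mat m m \<and>
        (m > 0 \<longrightarrow> numerical_radius B \<le> cos (pi / (real k + 2))) \<and>
        unitarily_similar A (diag_block_mat [jordan_block (k + 1) 0, B]))) \<and>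
    (numerical_radius A = cos (pi / (real k + 2)) \<longleftrightarrow>
      numerical_range A = {z. cmod z \<le> cos (pi / (real k + 2))})"
proof -
  let ?c = "cos (pi / (real k + 2))"
  \<comment> \<open>Condition (b) gets a name; the equivalences follow from the cycle (a) to (b) to
    (c) to (a).\<close>
  define b where "b \<longleftrightarrow> (\<exists>m B. n = k + 1 + m \<and> B \<in> carrier_mat m m \<and>
        (m > 0 \<longrightarrow> numerical_radius B \<le> ?c) \<and>
        unitarily_similar A (diag_block_mat [jordan_block (k + 1) 0, B]))"
  note A = assms(2)
  obtain x where "isometric_orbit A n k x"
    using isometric_orbit_exists[OF assms(2-4)] .
  then interpret isometric_orbit A n k x .
  note bound = norm_cscalar_prod_le_numerical_radius[OF A]
  have lower: "?c \<le> numerical_radius A"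
    by (rule lower_bound[OF bound])
  \<comment> \<open>The angle lies between 0 and pi / 2, so the radius is nonnegative and the disc
    nonempty, as the step from (c) to (a) requires.\<close>
  have "0 \<le> pi / (real k + 2)"
    by simp
  moreover have "pi / (real k + 2) \<le> pi / 2"
    by (rule divide_left_mono) auto
  ultimately have c: "0 \<le> ?c"
    by (intro cos_ge_zero) linarith+
  have ab: b if radius: "numerical_radius A = ?c"
  proof -
    have "cmod ((A *\<^sub>v v) \<bullet>c v) \<le> ?c * (l2_norm_vec v)\<^sup>2" if "v \<in> carrier_vec n" for v
      using bound[OF that] radius by simp
    note zero = extremal[OF this]
    obtain m B where mB: "n = k + 1 + m" "B \<in> carrier_mat m m"
      "unitarily_similar A (diag_block_mat [jordan_block (k + 1) 0, B])"
      using unitarily_similar_jordan_block_sum[OF zero] by metis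
    \<comment> \<open>The radius of \<open>B\<close> is controlled by that of \<open>A\<close>, of
      which \<open>B\<close> is a direct summand up to unitary similarity.\<close>
    have "numerical_range B \<subseteq> numerical_range A"
      unfolding numerical_range_unitarily_similar[OF A mB(3)]
      by (rule numerical_range_subset_diag_block(2)[OF jordan_block_carrier mB(2)])
    then have "numerical_radius B \<le> ?c" if "0 < m"
      using numerical_radius_mono[OF A mB(2) that] radius by simp
    then show b
      unfolding b_def using mB by blast
  qed
  have bc: "numerical_range A = {z. cmod z \<le> ?c}" if b
  proof -
    obtain m B where mB: "B \<in> carrier_mat m m" "0 < m \<longrightarrow> numerical_radius B \<le> ?c"
      "unitarily_similar A (diag_block_mat [jordan_block (k + 1) 0, B])"
      using \<open>b\<close> unfolding b_def by blast
    show ?thesis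
      unfolding numerical_range_unitarily_similar[OF A mB(3)]
      using numerical_range_jordan_block_sum[OF mB(1,2)] by simp
  qed
  have ca: "numerical_radius A = ?c" if "numerical_range A = {z. cmod z \<le> ?c}"
    by (rule numerical_radius_disc[OF that c])
  show ?thesis
    using lower ab bc ca unfolding b_def[symmetric] by blast
qed

end
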